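(* For each $n\in\mathbb{N}$ let $\mathcal{F}_n\subseteq \mathcal{C}^\infty(\mathbb{R}^n)$ be a set of smooth functions $\mathbb{R}^n\to\mathbb{R}$, and let $\mathcal{A}$ be the expansion of the ordered real field $(\mathbb{R},<,+,\cdot,0,1)$ by the functions in $\bigcup_{n\in\mathbb{N}}\mathcal{F}_n$. For $n\ge 1$ let $\mathcal{Z}_n$ be the collection of zero-sets $f^{-1}(0)$ of all definable functions $f\colon\mathbb{R}^n\to\mathbb{R}$, and suppose that the weak structure $\mathcal{Z}=(\mathcal{Z}_n)_{n\ge1}$ is o-minimal, i.e. every element of $\mathcal{Z}_1$ is a finite union of points and open intervals. Then the commutative ring with unity $\mathcal{H}_{\mathcal{A}}$ of germs at $+\infty$ of definable $\mathcal{C}^\infty$ unary functions is a Hardy field, and $\mathcal{H}_{\mathcal{A}}$ is isomorphic (as a ring with unity) to a subfield of (the underlying ring of) some $\mathcal{C}^\infty$-ring.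
   Context: "Definable" means first-order definable in $\mathcal{A}$ with parameters from $\mathbb{R}$. A definable $\mathcal{C}^\infty$ unary function is a definable smooth function $f\colon (c,+\infty)\to\mathbb{R}$ for some $c\in\mathbb{R}\cup\{-\infty\}$. Two continuous functions $f,g$ whose domains contain some interval $(c,+\infty)$ have the same germ at $+\infty$, $[f]=[g]$, if they agree on some interval $(a,+\infty)$; germs are added and multiplied pointwise. A Hardy field is a set of germs at $+\infty$ of continuous real functions which is a field under these operations and is closed under differentiation (if $[f]$ is in it then $[f']$ is in it). A $\mathcal{C}^\infty$-ring is a set $A$ with operations $\Phi_f\colon A^m\to A$ for every $m\ge 0$ and every smooth $f\colon\mathbb{R}^m\to\mathbb{R}$, such that $\Phi_{\pi_j}$ is the $j$-th projection $A^m\to A$ for each coordinate projection $\pi_j\colon\mathbb{R}^m\to\mathbb{R}$, and whenever $h=g\circ(f_1,\dots,f_n)$ with $f_i\colon\mathbb{R}^m\to\mathbb{R}$, $g\colon\mathbb{R}^n\to\mathbb{R}$ smooth, one has $\Phi_h(c_1,\dots,c_m)=\Phi_g(\Phi_{f_1}(c_1,\dots,c_m),\dots,\Phi_{f_n}(c_1,\dots,c_m))$ for all $c_i\in A$; in particular its underlying set is a commutative ring via $\Phi_+$, $\Phi_\cdot$. *)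

theory Defs
  imports "HOL-Analysis.Analysis" "HOL-Algebra.Subrings"
begin

section \<open>Smooth functions\<close>

text \<open>The points of \<open>\<real>\<^sup>n\<close> are those of the library topology \<^const>\<open>Euclidean_space\<close>, i.e. sequences
  that vanish from index \<open>n\<close> on.\<close>

abbreviation Rn :: "nat \<Rightarrow> (nat \<Rightarrow> real) set" where
  "Rn n \<equiv> topspace (Euclidean_space n)"

text \<open>\<open>Ck n k f\<close>: all iterated partial derivatives of \<open>f\<close> of order at most \<open>k\<close> exist and are
  continuous on \<open>\<real>\<^sup>n\<close>.\<close>

primrec Ck :: "nat \<Rightarrow> nat \<Rightarrow> ((nat \<Rightarrow> real) \<Rightarrow> real) \<Rightarrow> bool" where
  "Ck n 0 f \<longleftrightarrow> continuous_map (Euclidean_space n) euclideanreal f"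
| "Ck n (Suc k) f \<longleftrightarrow> continuous_map (Euclidean_space n) euclideanreal f \<and>
     (\<forall>i<n. \<exists>g. Ck n k g \<and>
       (\<forall>x\<in>Rn n. ((\<lambda>t. f (x(i := t))) has_real_derivative g x) (at (x i))))"

text \<open>\<open>C\<^sup>\<infinity>(\<real>\<^sup>n)\<close>. Extensionality makes each function \<open>\<real>\<^sup>n \<rightarrow> \<real>\<close> have exactly one representative.\<close>

definition Cinf :: "nat \<Rightarrow> ((nat \<Rightarrow> real) \<Rightarrow> real) set" where
  "Cinf n = {f \<in> extensional (Rn n). \<forall>k. Ck n k f}"

text \<open>For open \<open>S\<close> only: the iterated derivatives at points of \<open>S\<close> then depend only on \<open>f\<close> on \<open>S\<close>.\<close>

definition smooth_on_open :: "real set \<Rightarrow> (real \<Rightarrow> real) \<Rightarrow> bool" where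
  "smooth_on_open S f \<longleftrightarrow> (\<forall>k. \<forall>x\<in>S. ((deriv ^^ k) f) field_differentiable (at x))"


section \<open>First-order definability with parameters\<close>

definition vec_of :: "real list \<Rightarrow> nat \<Rightarrow> real" where
  "vec_of xs = (\<lambda>i. if i < length xs then xs ! i else 0)"

text \<open>\<open>Param r\<close> is the parameter \<open>r\<close>; \<open>Fun n f ts\<close> applies the symbol of the \<open>n\<close>-ary function \<open>f\<close>.\<close>

datatype tm =
    Var nat
  | Param real
  | Zero
  | One
  | Plus tm tm
  | Times tm tm
  | Fun nat "(nat \<Rightarrow> real) \<Rightarrow> real" "tm list"

datatype fm =
    Eq tm tm
  | Less tm tm
  | Neg fm
  | Conj fm fm
  | Exi nat fm

fun tm_in :: "(nat \<Rightarrow> ((nat \<Rightarrow> real) \<Rightarrow> real) set) \<Rightarrow> tm \<Rightarrow> bool" where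
  "tm_in F (Var i) \<longleftrightarrow> True"
| "tm_in F (Param r) \<longleftrightarrow> True"
| "tm_in F Zero \<longleftrightarrow> True"
| "tm_in F One \<longleftrightarrow> True"
| "tm_in F (Plus s t) \<longleftrightarrow> tm_in F s \<and> tm_in F t"
| "tm_in F (Times s t) \<longleftrightarrow> tm_in F s \<and> tm_in F t"
| "tm_in F (Fun n f ts) \<longleftrightarrow> f \<in> F n \<and> length ts = n \<and> (\<forall>t\<in>set ts. tm_in F t)"

fun fm_in :: "(nat \<Rightarrow> ((nat \<Rightarrow> real) \<Rightarrow> real) set) \<Rightarrow> fm \<Rightarrow> bool" where
  "fm_in F (Eq s t) \<longleftrightarrow> tm_in F s \<and> tm_in F t"
| "fm_in F (Less s t) \<longleftrightarrow> tm_in F s \<and> tm_in F t"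
| "fm_in F (Neg p) \<longleftrightarrow> fm_in F p"
| "fm_in F (Conj p q) \<longleftrightarrow> fm_in F p \<and> fm_in F q"
| "fm_in F (Exi i p) \<longleftrightarrow> fm_in F p"

fun tm_val :: "(nat \<Rightarrow> real) \<Rightarrow> tm \<Rightarrow> real" where
  "tm_val e (Var i) = e i"
| "tm_val e (Param r) = r"
| "tm_val e Zero = 0"
| "tm_val e One = 1"
| "tm_val e (Plus s t) = tm_val e s + tm_val e t"
| "tm_val e (Times s t) = tm_val e s * tm_val e t"
| "tm_val e (Fun n f ts) = f (vec_of (map (tm_val e) ts))"

fun sat :: "(nat \<Rightarrow> real) \<Rightarrow> fm \<Rightarrow> bool" where
  "sat e (Eq s t) \<longleftrightarrow> tm_val e s = tm_val e t"
| "sat e (Less s t) \<longleftrightarrow> tm_val e s < tm_val e t"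
| "sat e (Neg p) \<longleftrightarrow> \<not> sat e p"
| "sat e (Conj p q) \<longleftrightarrow> sat e p \<and> sat e q"
| "sat e (Exi i p) \<longleftrightarrow> (\<exists>t. sat (e(i := t)) p)"

text \<open>A free variable with index at least \<open>n\<close> is read as \<open>0\<close> at points of \<open>\<real>\<^sup>n\<close>, so it acts as
  one more parameter.\<close>

definition definable_set ::
    "(nat \<Rightarrow> ((nat \<Rightarrow> real) \<Rightarrow> real) set) \<Rightarrow> nat \<Rightarrow> (nat \<Rightarrow> real) set \<Rightarrow> bool" where
  "definable_set F n X \<longleftrightarrow> (\<exists>p. fm_in F p \<and> X = {x \<in> Rn n. sat x p})"

text \<open>For \<open>X \<subseteq> \<real>\<^sup>n\<close>: the graph of \<open>f : X \<rightarrow> \<real>\<close>, as a subset of \<open>\<real>\<^sup>n\<^sup>+\<^sup>1\<close>, is definable.\<close>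

definition definable_fun ::
    "(nat \<Rightarrow> ((nat \<Rightarrow> real) \<Rightarrow> real) set) \<Rightarrow> nat \<Rightarrow> (nat \<Rightarrow> real) set \<Rightarrow> ((nat \<Rightarrow> real) \<Rightarrow> real) \<Rightarrow> bool"
  where
  "definable_fun F n X f \<longleftrightarrow> X \<subseteq> Rn n \<and> definable_set F (Suc n) ((\<lambda>x. x(n := f x)) ` X)"


section \<open>The weak structure of zero-sets and o-minimality\<close>

definition zero_sets ::
    "(nat \<Rightarrow> ((nat \<Rightarrow> real) \<Rightarrow> real) set) \<Rightarrow> nat \<Rightarrow> (nat \<Rightarrow> real) set set" where
  "zero_sets F n = {{x \<in> Rn n. f x = 0} | f. definable_fun F n (Rn n) f}"

text \<open>Subsets of \<open>\<real>\<^sup>1\<close> are read as subsets of \<open>\<real>\<close> through the coordinate \<open>x 0\<close>; the endpoints of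
  open intervals may be infinite.\<close>

definition o_minimal :: "(nat \<Rightarrow> (nat \<Rightarrow> real) set set) \<Rightarrow> bool" where
  "o_minimal Z \<longleftrightarrow> (\<forall>S\<in>Z 1. \<exists>\<I>. finite \<I> \<and>
     (\<forall>I\<in>\<I>. (\<exists>p. I = {p}) \<or> (\<exists>a b. I = einterval a b)) \<and>
     (\<lambda>x. x 0) ` S = \<Union>\<I>)"


section \<open>Germs at infinity and Hardy fields\<close>

text \<open>A function on \<open>(c, \<infinity>)\<close> is represented by any total extension; its germ does not depend on
  the extension.\<close>

definition germ :: "(real \<Rightarrow> real) \<Rightarrow> (real \<Rightarrow> real) set" where
  "germ f = {g. \<forall>\<^sub>F x in at_top. g x = f x}"

definition continuous_germs :: "(real \<Rightarrow> real) set set" where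
  "continuous_germs = {germ f | f. \<exists>c. continuous_on {c<..} f}"

definition germ_ring :: "(real \<Rightarrow> real) set set \<Rightarrow> (real \<Rightarrow> real) set ring" where
  "germ_ring H =
    \<lparr>carrier = H,
     mult = (\<lambda>u v. {h. \<exists>f\<in>u. \<exists>g\<in>v. \<forall>\<^sub>F x in at_top. h x = f x * g x}),
     one = germ (\<lambda>_. 1),
     zero = germ (\<lambda>_. 0),
     add = (\<lambda>u v. {h. \<exists>f\<in>u. \<exists>g\<in>v. \<forall>\<^sub>F x in at_top. h x = f x + g x})\<rparr>"

definition hardy_field :: "(real \<Rightarrow> real) set set \<Rightarrow> bool" where
  "hardy_field H \<longleftrightarrow> H \<subseteq> continuous_germs \<and> field (germ_ring H) \<and>
     (\<forall>f. germ f \<in> H \<longrightarrow>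
       (\<exists>f'. (\<forall>\<^sub>F x in at_top. (f has_real_derivative f' x) (at x)) \<and> germ f' \<in> H))"

definition definable_smooth_unary ::
    "(nat \<Rightarrow> ((nat \<Rightarrow> real) \<Rightarrow> real) set) \<Rightarrow> ereal \<Rightarrow> (real \<Rightarrow> real) \<Rightarrow> bool" where
  "definable_smooth_unary F c f \<longleftrightarrow> c \<noteq> \<infinity> \<and> smooth_on_open (einterval c \<infinity>) f \<and>
     definable_fun F 1 {x \<in> Rn 1. x 0 \<in> einterval c \<infinity>} (\<lambda>x. f (x 0))"

definition definable_germs ::
    "(nat \<Rightarrow> ((nat \<Rightarrow> real) \<Rightarrow> real) set) \<Rightarrow> (real \<Rightarrow> real) set set" where
  "definable_germs F = {germ f | f. \<exists>c. definable_smooth_unary F c f}"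


section \<open>\<open>C\<^sup>\<infinity>\<close>-rings\<close>

definition proj_fun :: "nat \<Rightarrow> nat \<Rightarrow> (nat \<Rightarrow> real) \<Rightarrow> real" where
  "proj_fun m j = restrict (\<lambda>x. x j) (Rn m)"

definition comp_fun ::
    "nat \<Rightarrow> nat \<Rightarrow> ((nat \<Rightarrow> real) \<Rightarrow> real) \<Rightarrow> (nat \<Rightarrow> (nat \<Rightarrow> real) \<Rightarrow> real) \<Rightarrow> (nat \<Rightarrow> real) \<Rightarrow> real"
  where
  "comp_fun m n g f = restrict (\<lambda>x. g (\<lambda>i. if i < n then f i x else 0)) (Rn m)"

text \<open>\<open>\<Phi> m f\<close> is the operation \<open>A\<^sup>m \<rightarrow> A\<close> attached to \<open>f \<in> C\<^sup>\<infinity>(\<real>\<^sup>m)\<close>.\<close>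

definition cinf_ring ::
    "'a set \<Rightarrow> (nat \<Rightarrow> ((nat \<Rightarrow> real) \<Rightarrow> real) \<Rightarrow> (nat \<Rightarrow> 'a) \<Rightarrow> 'a) \<Rightarrow> bool" where
  "cinf_ring A \<Phi> \<longleftrightarrow>
     (\<forall>m. \<forall>f\<in>Cinf m. \<forall>c\<in>{..<m} \<rightarrow>\<^sub>E A. \<Phi> m f c \<in> A) \<and>
     (\<forall>m. \<forall>j<m. \<forall>c\<in>{..<m} \<rightarrow>\<^sub>E A. \<Phi> m (proj_fun m j) c = c j) \<and>
     (\<forall>m n. \<forall>g\<in>Cinf n. \<forall>f. (\<forall>i<n. f i \<in> Cinf m) \<longrightarrow>
        (\<forall>c\<in>{..<m} \<rightarrow>\<^sub>E A.
          \<Phi> m (comp_fun m n g f) c = \<Phi> n g (\<lambda>i\<in>{..<n}. \<Phi> m (f i) c)))"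

definition pair :: "'a \<Rightarrow> 'a \<Rightarrow> nat \<Rightarrow> 'a" where
  "pair a b = (\<lambda>i\<in>{..<2}. if i = 0 then a else b)"

text \<open>The underlying ring; its constants are the nullary operations of the constants \<open>0\<close> and \<open>1\<close>.\<close>

definition underlying_ring ::
    "'a set \<Rightarrow> (nat \<Rightarrow> ((nat \<Rightarrow> real) \<Rightarrow> real) \<Rightarrow> (nat \<Rightarrow> 'a) \<Rightarrow> 'a) \<Rightarrow> 'a ring" where
  "underlying_ring A \<Phi> =
    \<lparr>carrier = A,
     mult = (\<lambda>a b. \<Phi> 2 (restrict (\<lambda>x. x 0 * x 1) (Rn 2)) (pair a b)),
     one = \<Phi> 0 (restrict (\<lambda>_. 1) (Rn 0)) (\<lambda>_. undefined),
     zero = \<Phi> 0 (restrict (\<lambda>_. 0) (Rn 0)) (\<lambda>_. undefined),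
     add = (\<lambda>a b. \<Phi> 2 (restrict (\<lambda>x. x 0 + x 1) (Rn 2)) (pair a b))\<rparr>"

end

theory Submission
  imports Defs
begin

text \<open>The zeros of a definable \<open>f\<close> on a ray \<open>(c, \<infinity>)\<close> are the zero-set of the definable function on \<open>\<real>\<close>
  that continues \<open>f\<close> by \<open>1\<close>. So o-minimality of the
  zero-sets already forces a definable \<open>f\<close> to be eventually zero or eventually nonzero, which makes
  nonzero germs invertible. The derivative is definable by its \<open>\<epsilon>\<close>-\<open>\<delta>\<close> condition. The ambient
  \<open>C\<^sup>\<infinity>\<close>-ring is that of all smooth germs at \<open>+\<infinity>\<close>, on which smooth functions act by composition;
  the chain rule for continuous partial derivatives shows that they preserve smoothness.\<close>

section \<open>Smooth functions of one variable\<close>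

text \<open>Definability of a unary function only means that its graph is definable, so
  \<open>f x\<close> is not a term: wherever such a value is used, a bound variable \<open>u\<close>
  with \<open>u = f x\<close> stands for it. Division and absolute values must likewise be turned
  into polynomial conditions, and bound variables must not collide with the variables at which a
  relation is evaluated. On the analytic side, \<open>Ck\<close> speaks of partial derivatives only,
  so the chain rule has to come from these alone. \<open>Dk\<close> replaces iterated
  \<open>deriv\<close> by a witness derivative at each order, which suits induction on the order. It
  does not ask the last derivative to be continuous; once all orders are required, this makes no
  difference.\<close>

primrec Dk :: "nat \<Rightarrow> real set \<Rightarrow> (real \<Rightarrow> real) \<Rightarrow> bool" where
  "Dk 0 S f \<longleftrightarrow> True"
| "Dk (Suc k) S f \<longleftrightarrow>
     (\<exists>f'. (\<forall>x\<in>S. (f has_real_derivative f' x) (at x)) \<and> Dk k S f')"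

lemma Dk_cong:
  assumes "open S" "\<And>x. x \<in> S \<Longrightarrow> f x = g x" "Dk k S f"
  shows "Dk k S g"
  using assms(2,3)
proof (induction k arbitrary: f g)
  case (Suc k)
  then obtain f' where f': "\<And>x. x \<in> S \<Longrightarrow> (f has_real_derivative f' x) (at x)" "Dk k S f'"
    unfolding Dk.simps by blast
  have "(g has_real_derivative f' x) (at x)" if "x \<in> S" for x
    using has_field_derivative_transform_within_open[OF f'(1) \<open>open S\<close>] Suc.prems(1) that by blast
  then show ?case using f'(2) by auto
qed simp

lemma Dk_mono: "S \<subseteq> T \<Longrightarrow> Dk k T f \<Longrightarrow> Dk k S f"
  by (induction k arbitrary: f) auto

lemma Dk_Suc_imp: "Dk (Suc k) S f \<Longrightarrow> Dk k S f"
  by (induction k arbitrary: f) auto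

lemma Dk_const: "Dk k S (\<lambda>_. c)"
  by (induction k arbitrary: c) (auto intro!: exI[of _ "\<lambda>_. 0"])

lemma Dk_add: "Dk k S f \<Longrightarrow> Dk k S g \<Longrightarrow> Dk k S (\<lambda>x. f x + g x)"
proof (induction k arbitrary: f g)
  case (Suc k)
  then obtain f' g' where
    "\<forall>x\<in>S. (f has_real_derivative f' x) (at x)" "Dk k S f'"
    "\<forall>x\<in>S. (g has_real_derivative g' x) (at x)" "Dk k S g'" by auto
  with Suc.IH show ?case
    by (auto intro!: exI[of _ "\<lambda>x. f' x + g' x"] derivative_intros)
qed simp

lemma Dk_sum: "(\<And>i. i \<in> I \<Longrightarrow> Dk k S (f i)) \<Longrightarrow> Dk k S (\<lambda>x. \<Sum>i\<in>I. f i x)"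
  by (induction I rule: infinite_finite_induct) (auto simp: Dk_const intro: Dk_add)

lemma Dk_mult: "Dk k S f \<Longrightarrow> Dk k S g \<Longrightarrow> Dk k S (\<lambda>x. f x * g x)"
proof (induction k arbitrary: f g)
  case (Suc k)
  from Suc.prems obtain f' g' where
    d: "\<forall>x\<in>S. (f has_real_derivative f' x) (at x)" "Dk k S f'"
    "\<forall>x\<in>S. (g has_real_derivative g' x) (at x)" "Dk k S g'" by auto
  \<comment> \<open>The product rule keeps one factor undifferentiated, so order \<open>k\<close> is
    needed for \<open>f\<close> and \<open>g\<close> as well as for their derivatives.\<close>
  have "Dk k S f" "Dk k S g" using Suc.prems Dk_Suc_imp by blast+
  then have "Dk k S (\<lambda>x. f x * g' x + f' x * g x)"
    using d Suc.IH by (intro Dk_add) auto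
  moreover have "\<forall>x\<in>S. ((\<lambda>x. f x * g x) has_real_derivative f x * g' x + f' x * g x) (at x)"
    using d by (auto intro!: derivative_eq_intros)
  ultimately show ?case
    by (auto intro!: exI[of _ "\<lambda>x. f x * g' x + f' x * g x"])
qed simp

lemma Dk_inverse:
  assumes "\<And>x. x \<in> S \<Longrightarrow> f x \<noteq> 0" "Dk k S f"
  shows "Dk k S (\<lambda>x. inverse (f x))"
  using assms(2)
proof (induction k)
  case (Suc k)
  then obtain f' where
    f': "\<forall>x\<in>S. (f has_real_derivative f' x) (at x)" "Dk k S f'" by auto
  have "Dk k S (\<lambda>x. inverse (f x))" using Suc Dk_Suc_imp by blast
  \<comment> \<open>This is \<open>- f' / f^2\<close>, arranged as a product of a constant,
    \<open>f'\<close> and two copies of \<open>inverse f\<close>, which is known to have order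
    \<open>k\<close> by induction.\<close>
  then have "Dk k S (\<lambda>x. - 1 * (inverse (f x) * f' x * inverse (f x)))"
    using f' by (intro Dk_mult Dk_const) auto
  moreover have "\<forall>x\<in>S. ((\<lambda>x. inverse (f x)) has_real_derivative
      - 1 * (inverse (f x) * f' x * inverse (f x))) (at x)"
    using f' assms(1) by (auto intro!: derivative_eq_intros)
  ultimately show ?case
    by (auto intro!: exI[of _ "\<lambda>x. - 1 * (inverse (f x) * f' x * inverse (f x))"])
qed simp

text \<open>A witness derivative agrees with \<open>deriv\<close> on \<open>S\<close> only; as
  \<open>S\<close> is open, this is enough to exchange them before the next differentiation. In the
  backward direction order \<open>Suc k\<close> is used because the \<open>k\<close>-th derivative
  must itself be differentiable.\<close>

lemma smooth_on_open_iff_Dk: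
  assumes "open S"
  shows "smooth_on_open S f \<longleftrightarrow> (\<forall>k. Dk k S f)"
proof
  have *: "Dk k S g" if "smooth_on_open S g" for k g
    using that
  proof (induction k arbitrary: g)
    case (Suc k)
    have "g field_differentiable (at x)" if "x \<in> S" for x
      using Suc.prems that unfolding smooth_on_open_def by (metis funpow_0)
    then have "\<forall>x\<in>S. (g has_real_derivative deriv g x) (at x)"
      by (simp add: DERIV_deriv_iff_field_differentiable)
    moreover have "smooth_on_open S (deriv g)"
      using Suc.prems unfolding smooth_on_open_def by (metis funpow_swap1 funpow.simps(2) comp_apply)
    ultimately show ?case using Suc.IH by auto
  qed simp
  then show "\<forall>k. Dk k S f" if "smooth_on_open S f" using that by blast
next
  have *: "((deriv ^^ k) g) field_differentiable (at x)" if "Dk (Suc k) S g" "x \<in> S" for g k x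
    using that
  proof (induction k arbitrary: g)
    case 0
    then show ?case by (auto simp: field_differentiable_def)
  next
    case (Suc k)
    from Suc.prems(1) obtain g' where
      g': "\<And>y. y \<in> S \<Longrightarrow> (g has_real_derivative g' y) (at y)" "Dk (Suc k) S g'"
      by (auto simp del: Dk.simps(2) simp: Dk.simps(2)[of "Suc k"])
    have "Dk (Suc k) S (deriv g)"
      using Dk_cong[OF \<open>open S\<close> _ g'(2)] DERIV_imp_deriv[OF g'(1)] by metis
    from Suc.IH[OF this Suc.prems(2)] show ?case
      by (simp add: funpow_swap1)
  qed
  then show "smooth_on_open S f" if "\<forall>k. Dk k S f"
    using that * unfolding smooth_on_open_def by blast
qed

section \<open>Composition of smooth functions\<close>

lemma continuous_map_Euclidean_space_real_iff:
  "continuous_map (Euclidean_space n) euclideanreal f \<longleftrightarrow> continuous_on (Rn n) f"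
  by (simp add: Euclidean_space_def topspace_Euclidean_space euclidean_product_topology)

text \<open>The topology on functions is the product topology. This turns coordinatewise limits of
  evaluation points into limits to which continuity on \<open>Rn n\<close> applies.\<close>

lemma tendsto_fun_componentwise:
  fixes f :: "'a \<Rightarrow> 'i \<Rightarrow> 'b::topological_space"
  assumes "\<And>i. ((\<lambda>t. f t i) \<longlongrightarrow> l i) F"
  shows "(f \<longlongrightarrow> l) F"
proof -
  have "limitin (product_topology (\<lambda>_::'i. euclidean) UNIV) f l F"
    unfolding limitin_componentwise using assms by (simp add: limitin_canonical_iff)
  then show ?thesis by (simp add: euclidean_product_topology limitin_canonical_iff)
qed

text \<open>The estimate on \<open>\<xi>\<close> covers both orders of \<open>a\<close> and
  \<open>b\<close> and also \<open>a = b\<close>; it forces \<open>\<xi>\<close> to tend to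
  \<open>a\<close> when \<open>b\<close> does.\<close>

lemma real_mean_value_point:
  fixes \<phi> :: "real \<Rightarrow> real"
  assumes "\<And>s. (\<phi> has_real_derivative \<psi> s) (at s)"
  shows "\<exists>\<xi>. \<phi> b - \<phi> a = \<psi> \<xi> * (b - a) \<and> \<bar>\<xi> - a\<bar> \<le> \<bar>b - a\<bar>"
proof (cases a b rule: linorder_cases)
  case less
  then obtain z where "a < z" "z < b" "\<phi> b - \<phi> a = (b - a) * \<psi> z"
    using MVT2[of a b \<phi> \<psi>] assms by blast
  then show ?thesis by (intro exI[of _ z]) auto
next
  case greater
  then obtain z where "b < z" "z < a" "\<phi> a - \<phi> b = (a - b) * \<psi> z"
    using MVT2[of b a \<phi> \<psi>] assms by blast
  then show ?thesis by (intro exI[of _ z]) (auto simp: algebra_simps)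
qed auto

text \<open>The coordinates are moved from \<open>t0\<close> to \<open>t\<close> one at a time: in
  \<open>w m t\<close> the first \<open>m\<close> have moved and the rest are frozen. Each increment
  changes a single coordinate, so the mean value theorem expresses it by one partial derivative,
  whose continuity gives the limit.\<close>

lemma has_real_derivative_comp_partial:
  fixes f :: "(nat \<Rightarrow> real) \<Rightarrow> real"
  assumes cont: "\<And>i. i < n \<Longrightarrow> continuous_on (Rn n) (g i)"
    and partial: "\<And>i x. i < n \<Longrightarrow> x \<in> Rn n \<Longrightarrow>
      ((\<lambda>t. f (x(i := t))) has_real_derivative g i x) (at (x i))"
    and h: "\<And>i. i < n \<Longrightarrow> (h i has_real_derivative h' i) (at t0)"
  shows "((\<lambda>t. f (\<lambda>i. if i < n then h i t else 0)) has_real_derivative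
           (\<Sum>i<n. g i (\<lambda>i. if i < n then h i t0 else 0) * h' i)) (at t0)"
proof -
  define w where "w m t = (\<lambda>i. if i < m then h i t else if i < n then h i t0 else 0)" for m t
  define H where "H = (\<lambda>i. if i < n then h i t0 else 0)"
  have "((\<lambda>t. f (w m t)) has_real_derivative (\<Sum>i<m. g i H * h' i)) (at t0)" if "m \<le> n" for m
    using that
  proof (induction m)
    case 0
    then show ?case by (simp add: w_def)
  next
    case (Suc m)
    then have m: "m < n" by simp
    have wRn: "(w m t)(m := s) \<in> Rn n" for t s
      using m by (auto simp: w_def topspace_Euclidean_space)
    have ww: "w (Suc m) t = (w m t)(m := h m t)" "w m t = (w m t)(m := h m t0)" for t
      using m by (auto simp: w_def fun_eq_iff less_Suc_eq)
    have "((\<lambda>s. f ((w m t)(m := s))) has_real_derivative g m ((w m t)(m := s))) (at s)" for t s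
      using partial[OF m wRn[of t s]] by simp
    then have "\<exists>\<xi>. f ((w m t)(m := h m t)) - f ((w m t)(m := h m t0))
          = g m ((w m t)(m := \<xi>)) * (h m t - h m t0) \<and> \<bar>\<xi> - h m t0\<bar> \<le> \<bar>h m t - h m t0\<bar>" for t
      by (rule real_mean_value_point)
    \<comment> \<open>The points \<open>\<xi> t\<close> are chosen with no regularity in
      \<open>t\<close>; the squeeze by \<open>h m t - h m t0\<close> alone yields their limit at
      \<open>t0\<close>.\<close>
    then obtain \<xi> where
      \<xi>: "\<And>t. f (w (Suc m) t) - f (w m t) = g m ((w m t)(m := \<xi> t)) * (h m t - h m t0)"
         "\<And>t. \<bar>\<xi> t - h m t0\<bar> \<le> \<bar>h m t - h m t0\<bar>"
      using ww by metis
    define q where "q t = g m ((w m t)(m := \<xi> t))" for t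
    have hlim: "(h i \<longlongrightarrow> h i t0) (at t0)" if "i < n" for i
      using h[OF that] DERIV_isCont isCont_def by blast
    have "((\<lambda>t. \<xi> t - h m t0) \<longlongrightarrow> 0) (at t0)"
    proof (rule Lim_null_comparison)
      show "\<forall>\<^sub>F t in at t0. norm (\<xi> t - h m t0) \<le> \<bar>h m t - h m t0\<bar>"
        using \<xi>(2) by auto
      show "((\<lambda>t. \<bar>h m t - h m t0\<bar>) \<longlongrightarrow> 0) (at t0)"
        using hlim[OF m] by (simp add: LIM_zero tendsto_rabs_zero)
    qed
    then have \<xi>lim: "(\<xi> \<longlongrightarrow> h m t0) (at t0)" by (simp add: LIM_zero_iff)
    have "((\<lambda>t. (w m t)(m := \<xi> t)) \<longlongrightarrow> H) (at t0)"
    proof (rule tendsto_fun_componentwise)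
      fix i
      show "((\<lambda>t. ((w m t)(m := \<xi> t)) i) \<longlongrightarrow> H i) (at t0)"
        using \<xi>lim hlim m by (cases "i = m"; cases "i < m") (auto simp: w_def H_def)
    qed
    then have "(q \<longlongrightarrow> g m H) (at t0)"
      unfolding q_def
    proof (rule continuous_on_tendsto_compose[OF cont[OF m]])
      show "H \<in> Rn n" by (simp add: H_def topspace_Euclidean_space)
      show "\<forall>\<^sub>F t in at t0. (w m t)(m := \<xi> t) \<in> Rn n"
        by (intro always_eventually allI wRn)
    qed
    \<comment> \<open>At \<open>t = t0\<close> the bound leaves only
      \<open>\<xi> t0 = h m t0\<close>, so \<open>q\<close> takes its limit as value and is
      continuous there.\<close>
    moreover have "q t0 = g m H"
    proof -
      have "\<xi> t0 = h m t0" using \<xi>(2)[of t0] by simp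
      then have "(w m t0)(m := \<xi> t0) = H" using m by (auto simp: w_def H_def)
      then show ?thesis by (simp add: q_def)
    qed
    ultimately have qc: "isCont q t0" by (simp add: isCont_def)
    \<comment> \<open>Caratheodory's form of the derivative avoids difference quotients: the
      increment is \<open>t - t0\<close> times a product of two functions continuous at
      \<open>t0\<close>.\<close>
    from h[OF m] obtain k where
      k: "\<And>t. h m t - h m t0 = k t * (t - t0)" "isCont k t0" "k t0 = h' m"
      unfolding CARAT_DERIV by blast
    have "f (w (Suc m) t) - f (w m t) = q t * k t * (t - t0)" for t
      using \<xi>(1)[of t] k(1)[of t] by (simp add: q_def)
    moreover have "isCont (\<lambda>t. q t * k t) t0" using qc k(2) by (rule isCont_mult)
    ultimately have "((\<lambda>t. f (w (Suc m) t) - f (w m t)) has_real_derivative g m H * h' m) (at t0)"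
      unfolding CARAT_DERIV
      using k(3) \<open>q t0 = g m H\<close> by (intro exI[of _ "\<lambda>t. q t * k t"]) simp
    from DERIV_add[OF Suc.IH this] m show ?case by simp
  qed
  from this[of n] show ?thesis by (simp add: w_def H_def cong: if_cong)
qed

text \<open>By the chain rule the derivative is a sum of products of some \<open>h' i\<close> with a
  composition of the same shape, whose outer function is a partial derivative of order
  \<open>k\<close>. The induction therefore varies \<open>f\<close> and keeps
  \<open>h\<close>.\<close>

lemma Dk_comp_Ck:
  assumes "Ck n k f" "\<And>i. i < n \<Longrightarrow> Dk k S (h i)"
  shows "Dk k S (\<lambda>t. f (\<lambda>i. if i < n then h i t else 0))"
  using assms
proof (induction k arbitrary: f)
  case (Suc k)
  from Suc.prems(1) obtain g where
    g: "\<And>i. i < n \<Longrightarrow> Ck n k (g i)"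
       "\<And>i x. i < n \<Longrightarrow> x \<in> Rn n \<Longrightarrow>
          ((\<lambda>t. f (x(i := t))) has_real_derivative g i x) (at (x i))"
    unfolding Ck.simps by metis
  from Suc.prems(2) obtain h' where
    h': "\<And>i x. i < n \<Longrightarrow> x \<in> S \<Longrightarrow> (h i has_real_derivative h' i x) (at x)"
        "\<And>i. i < n \<Longrightarrow> Dk k S (h' i)"
    unfolding Dk.simps by metis
  have "continuous_on (Rn n) (g i)" if "i < n" for i
    using g(1)[OF that] by (cases k) (simp_all add: continuous_map_Euclidean_space_real_iff)
  from has_real_derivative_comp_partial[OF this g(2) h'(1)]
  have "\<forall>t\<in>S. ((\<lambda>t. f (\<lambda>i. if i < n then h i t else 0)) has_real_derivative
      (\<Sum>i<n. g i (\<lambda>i. if i < n then h i t else 0) * h' i t)) (at t)"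
    by auto
  moreover have "Dk k S (\<lambda>t. \<Sum>i<n. g i (\<lambda>i. if i < n then h i t else 0) * h' i t)"
    using Suc.IH g(1) h'(2) Dk_Suc_imp Suc.prems(2) by (intro Dk_sum Dk_mult) auto
  ultimately show ?case unfolding Dk.simps
    by (intro exI[of _ "\<lambda>t. \<Sum>i<n. g i (\<lambda>i. if i < n then h i t else 0) * h' i t"] conjI)
qed simp

section \<open>Closure properties of definability\<close>

text \<open>A semantic view of formulas: predicates on all environments, not only on points of
  \<open>Rn n\<close>. Formulas can then be assembled by introduction rules without writing
  syntax.\<close>

definition dpred :: "(nat \<Rightarrow> ((nat \<Rightarrow> real) \<Rightarrow> real) set) \<Rightarrow> ((nat \<Rightarrow> real) \<Rightarrow> bool) \<Rightarrow> bool" where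
  "dpred F P \<longleftrightarrow> (\<exists>p. fm_in F p \<and> (\<forall>e. sat e p = P e))"

definition dterm :: "(nat \<Rightarrow> ((nat \<Rightarrow> real) \<Rightarrow> real) set) \<Rightarrow> ((nat \<Rightarrow> real) \<Rightarrow> real) \<Rightarrow> bool" where
  "dterm F T \<longleftrightarrow> (\<exists>t. tm_in F t \<and> (\<forall>e. tm_val e t = T e))"

lemma dterm_var: "dterm F (\<lambda>e. e i)"
  unfolding dterm_def by (intro exI[of _ "Var i"]) simp

lemma dterm_const: "dterm F (\<lambda>_. r)"
  unfolding dterm_def by (intro exI[of _ "Param r"]) simp

lemma dterm_add: "dterm F S \<Longrightarrow> dterm F T \<Longrightarrow> dterm F (\<lambda>e. S e + T e)"
proof -
  assume "dterm F S" "dterm F T"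
  then obtain s t where "tm_in F s" "\<And>e. tm_val e s = S e" "tm_in F t" "\<And>e. tm_val e t = T e"
    unfolding dterm_def by blast
  then show ?thesis unfolding dterm_def by (intro exI[of _ "Plus s t"]) simp
qed

lemma dterm_mult: "dterm F S \<Longrightarrow> dterm F T \<Longrightarrow> dterm F (\<lambda>e. S e * T e)"
proof -
  assume "dterm F S" "dterm F T"
  then obtain s t where "tm_in F s" "\<And>e. tm_val e s = S e" "tm_in F t" "\<And>e. tm_val e t = T e"
    unfolding dterm_def by blast
  then show ?thesis unfolding dterm_def by (intro exI[of _ "Times s t"]) simp
qed

text \<open>The language has no subtraction; the parameter \<open>- 1\<close> supplies it.\<close>

lemma dterm_diff: "dterm F S \<Longrightarrow> dterm F T \<Longrightarrow> dterm F (\<lambda>e. S e - T e)"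
  using dterm_add[of F S "\<lambda>e. - 1 * T e"] dterm_mult[OF dterm_const[of F "- 1"], of T] by simp

lemma dterm_power: "dterm F T \<Longrightarrow> dterm F (\<lambda>e. T e ^ k)"
  by (induction k) (simp_all add: dterm_const dterm_mult)

lemma dpred_eq: "dterm F S \<Longrightarrow> dterm F T \<Longrightarrow> dpred F (\<lambda>e. S e = T e)"
proof -
  assume "dterm F S" "dterm F T"
  then obtain s t where "tm_in F s" "\<And>e. tm_val e s = S e" "tm_in F t" "\<And>e. tm_val e t = T e"
    unfolding dterm_def by blast
  then show ?thesis unfolding dpred_def by (intro exI[of _ "Eq s t"]) simp
qed

lemma dpred_less: "dterm F S \<Longrightarrow> dterm F T \<Longrightarrow> dpred F (\<lambda>e. S e < T e)"
proof -
  assume "dterm F S" "dterm F T"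
  then obtain s t where "tm_in F s" "\<And>e. tm_val e s = S e" "tm_in F t" "\<And>e. tm_val e t = T e"
    unfolding dterm_def by blast
  then show ?thesis unfolding dpred_def by (intro exI[of _ "Less s t"]) simp
qed

lemma dpred_not: "dpred F P \<Longrightarrow> dpred F (\<lambda>e. \<not> P e)"
proof -
  assume "dpred F P"
  then obtain p where "fm_in F p" "\<And>e. sat e p = P e"
    unfolding dpred_def by blast
  then show ?thesis unfolding dpred_def by (intro exI[of _ "Neg p"]) simp
qed

lemma dpred_conj: "dpred F P \<Longrightarrow> dpred F Q \<Longrightarrow> dpred F (\<lambda>e. P e \<and> Q e)"
proof -
  assume "dpred F P" "dpred F Q"
  then obtain p q where "fm_in F p" "\<And>e. sat e p = P e" "fm_in F q" "\<And>e. sat e q = Q e"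
    unfolding dpred_def by blast
  then show ?thesis unfolding dpred_def by (intro exI[of _ "Conj p q"]) simp
qed

lemma dpred_disj: "dpred F P \<Longrightarrow> dpred F Q \<Longrightarrow> dpred F (\<lambda>e. P e \<or> Q e)"
  using dpred_not[OF dpred_conj[OF dpred_not[of F P] dpred_not[of F Q]]] by simp

lemma dpred_imp: "dpred F P \<Longrightarrow> dpred F Q \<Longrightarrow> dpred F (\<lambda>e. P e \<longrightarrow> Q e)"
  unfolding imp_conv_disj by (intro dpred_disj dpred_not)

lemma dpred_le: "dterm F S \<Longrightarrow> dterm F T \<Longrightarrow> dpred F (\<lambda>e. S e \<le> T e)"
  using dpred_not[OF dpred_less[of F T S]] by (simp add: not_less)

text \<open>The index \<open>i\<close> names the bound variable, which must not occur in the remaining arguments.\<close>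

lemma dpred_ex:
  assumes "dpred F (\<lambda>e. P e (e i))" "\<And>e t s. P (e(i := t)) s = P e s"
  shows "dpred F (\<lambda>e. \<exists>t. P e t)"
proof -
  obtain p where "fm_in F p" "\<And>e. sat e p = P e (e i)"
    using assms(1) unfolding dpred_def by blast
  with assms(2) show ?thesis
    unfolding dpred_def by (intro exI[of _ "Exi i p"]) simp
qed

lemma dpred_all:
  assumes "dpred F (\<lambda>e. P e (e i))" "\<And>e t s. P (e(i := t)) s = P e s"
  shows "dpred F (\<lambda>e. \<forall>t. P e t)"
  using dpred_not[OF dpred_ex[of F "\<lambda>e t. \<not> P e t" i]] dpred_not[OF assms(1)] assms(2) by simp

lemmas dpred_intros =
  dpred_eq dpred_less dpred_le dpred_not dpred_conj dpred_disj dpred_imp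
  dterm_var dterm_const dterm_add dterm_mult dterm_diff dterm_power

section \<open>Renaming of free variables\<close>

text \<open>\<open>None\<close> stands for the value \<open>0\<close> that a free variable of too large index receives.\<close>

definition rename_env :: "(nat \<Rightarrow> nat option) \<Rightarrow> (nat \<Rightarrow> real) \<Rightarrow> nat \<Rightarrow> real" where
  "rename_env \<sigma> e j = (case \<sigma> j of None \<Rightarrow> 0 | Some k \<Rightarrow> e k)"

lemma tm_rename: "tm_in F t \<Longrightarrow> \<exists>t'. tm_in F t' \<and> (\<forall>e. tm_val e t' = tm_val (rename_env \<sigma> e) t)"
proof (induction t)
  case (Var i)
  show ?case
  proof (cases "\<sigma> i")
    case None
    then show ?thesis by (intro exI[of _ Zero]) (simp add: rename_env_def)
  next
    case (Some k)
    then show ?thesis by (intro exI[of _ "Var k"]) (simp add: rename_env_def)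
  qed
next
  case (Param r)
  show ?case by (intro exI[of _ "Param r"]) simp
next
  case Zero
  show ?case by (intro exI[of _ Zero]) simp
next
  case One
  show ?case by (intro exI[of _ One]) simp
next
  case (Plus s t)
  then show ?case by (metis tm_in.simps(5) tm_val.simps(5))
next
  case (Times s t)
  then show ?case by (metis tm_in.simps(6) tm_val.simps(6))
next
  case (Fun n f ts)
  then have "\<forall>t\<in>set ts. \<exists>t'. tm_in F t' \<and> (\<forall>e. tm_val e t' = tm_val (rename_env \<sigma> e) t)"
    by auto
  then obtain r where
    r: "\<And>t. t \<in> set ts \<Longrightarrow> tm_in F (r t)"
       "\<And>t e. t \<in> set ts \<Longrightarrow> tm_val e (r t) = tm_val (rename_env \<sigma> e) t"
    by metis
  have "map (tm_val e) (map r ts) = map (tm_val (rename_env \<sigma> e)) ts" for e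
    using r(2) by simp
  then have "tm_val e (Fun n f (map r ts)) = tm_val (rename_env \<sigma> e) (Fun n f ts)" for e
    by (metis tm_val.simps(7))
  moreover have "tm_in F (Fun n f (map r ts))" using Fun.prems r(1) by auto
  ultimately show ?case by blast
qed

lemma fm_rename:
  "fm_in F p \<Longrightarrow> finite (ran \<sigma>) \<Longrightarrow> \<exists>q. fm_in F q \<and> (\<forall>e. sat e q = sat (rename_env \<sigma> e) p)"
proof (induction p arbitrary: \<sigma>)
  case (Eq s t)
  then show ?case
    using tm_rename[of F s \<sigma>] tm_rename[of F t \<sigma>] by (metis fm_in.simps(1) sat.simps(1))
next
  case (Less s t)
  then show ?case
    using tm_rename[of F s \<sigma>] tm_rename[of F t \<sigma>] by (metis fm_in.simps(2) sat.simps(2))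
next
  case (Neg p)
  then show ?case by (metis fm_in.simps(3) sat.simps(3))
next
  case (Conj p q)
  then show ?case by (metis fm_in.simps(4) sat.simps(4))
next
  case (Exi i p)
  \<comment> \<open>The bound variable moves to an index that no renamed variable uses; otherwise
    the quantifier would capture one of them. Finiteness of \<open>ran \<sigma>\<close> provides
    such an index, and it survives the extension of \<open>\<sigma>\<close>.\<close>
  obtain k where k: "k \<notin> ran \<sigma>"
    using Exi.prems(2) ex_new_if_finite infinite_UNIV_nat by blast
  have "finite (ran (\<sigma>(i \<mapsto> k)))"
    by (rule finite_subset[of _ "insert k (ran \<sigma>)"]) (use Exi.prems(2) in \<open>auto simp: ran_def\<close>)
  with Exi obtain q where
    q: "fm_in F q" "\<And>e. sat e q = sat (rename_env (\<sigma>(i \<mapsto> k)) e) p"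
    by (metis fm_in.simps(5))
  have "rename_env (\<sigma>(i \<mapsto> k)) (e(k := t)) = (rename_env \<sigma> e)(i := t)" for e t
    using k by (auto simp: rename_env_def fun_eq_iff ran_def split: option.splits)
  with q show ?case by (intro exI[of _ "Exi k q"]) simp
qed

section \<open>Definable binary relations and definable functions on rays\<close>

definition drel :: "(nat \<Rightarrow> ((nat \<Rightarrow> real) \<Rightarrow> real) set) \<Rightarrow> (real \<Rightarrow> real \<Rightarrow> bool) \<Rightarrow> bool" where
  "drel F G \<longleftrightarrow> (\<forall>i j. dpred F (\<lambda>e. G (e i) (e j)))"

text \<open>\<open>drel\<close> quantifies over the indices so that a relation can be placed at any
  two variables of a larger formula. One pair suffices: renaming carries \<open>0\<close> and
  \<open>1\<close> to \<open>i\<close> and \<open>j\<close>, and all other variables may be read as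
  \<open>0\<close> because the truth value depends on these two only.\<close>

lemma drelI:
  assumes "dpred F (\<lambda>e. G (e 0) (e 1))"
  shows "drel F G"
  unfolding drel_def
proof (intro allI)
  fix i j :: nat
  obtain p where p: "fm_in F p" "\<And>e. sat e p = G (e 0) (e 1)"
    using assms unfolding dpred_def by blast
  define \<sigma> where "\<sigma> = [0::nat \<mapsto> i, 1 \<mapsto> j]"
  have "finite (ran \<sigma>)" by (simp add: \<sigma>_def finite_ran)
  from fm_rename[OF p(1) this] obtain q where
    q: "fm_in F q" "\<And>e. sat e q = sat (rename_env \<sigma> e) p" by blast
  have "sat e q = G (e i) (e j)" for e
    by (simp add: q(2) p(2) rename_env_def \<sigma>_def)
  with q(1) show "dpred F (\<lambda>e. G (e i) (e j))" unfolding dpred_def by blast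
qed

lemma drelD: "drel F G \<Longrightarrow> dpred F (\<lambda>e. G (e i) (e j))"
  by (simp add: drel_def)

lemma definable_fun_unary_iff:
  "definable_fun F 1 {x \<in> Rn 1. x 0 \<in> S} (\<lambda>x. f (x 0)) \<longleftrightarrow> drel F (\<lambda>x y. x \<in> S \<and> y = f x)"
proof -
  have "(\<lambda>x. x(1 := f (x 0))) ` {x \<in> Rn 1. x 0 \<in> S} = {x \<in> Rn 2. x 0 \<in> S \<and> x 1 = f (x 0)}"
    (is "?L = ?R")
  proof
    show "?L \<subseteq> ?R" by (auto simp: topspace_Euclidean_space)
    show "?R \<subseteq> ?L"
    proof
      fix x assume x: "x \<in> ?R"
      then have "x = (x(1 := 0))(1 := f ((x(1 := 0)) 0))" by (simp add: fun_eq_iff)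
      moreover have "x(1 := 0) \<in> {x \<in> Rn 1. x 0 \<in> S}"
        using x by (auto simp: topspace_Euclidean_space)
      ultimately show "x \<in> ?L" by (rule image_eqI)
    qed
  qed
  then have eq: "definable_fun F 1 {x \<in> Rn 1. x 0 \<in> S} (\<lambda>x. f (x 0)) \<longleftrightarrow>
      (\<exists>p. fm_in F p \<and> {x \<in> Rn 2. x 0 \<in> S \<and> x 1 = f (x 0)} = {x \<in> Rn 2. sat x p})"
    by (auto simp: definable_fun_def definable_set_def numeral_2_eq_2)
  show ?thesis
  proof
    assume "definable_fun F 1 {x \<in> Rn 1. x 0 \<in> S} (\<lambda>x. f (x 0))"
    then obtain p where
      p: "fm_in F p" "\<And>x. x \<in> Rn 2 \<Longrightarrow> sat x p \<longleftrightarrow> x 0 \<in> S \<and> x 1 = f (x 0)"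
      unfolding eq by blast
    \<comment> \<open>The formula \<open>p\<close> is controlled only at points of
      \<open>Rn 2\<close>. Sending every index beyond \<open>1\<close> to \<open>None\<close> makes
      each environment look like such a point.\<close>
    define \<sigma> where "\<sigma> = [0::nat \<mapsto> 0::nat, 1 \<mapsto> 1]"
    have "finite (ran \<sigma>)" by (simp add: \<sigma>_def finite_ran)
    from fm_rename[OF p(1) this] obtain q where
      q: "fm_in F q" "\<And>e. sat e q = sat (rename_env \<sigma> e) p" by blast
    have "rename_env \<sigma> e \<in> Rn 2" for e
      by (auto simp: topspace_Euclidean_space rename_env_def \<sigma>_def)
    then have "sat e q \<longleftrightarrow> e 0 \<in> S \<and> e 1 = f (e 0)" for e
      using q(2) p(2) by (simp add: rename_env_def \<sigma>_def)
    with q(1) show "drel F (\<lambda>x y. x \<in> S \<and> y = f x)"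
      by (intro drelI) (auto simp: dpred_def)
  next
    assume "drel F (\<lambda>x y. x \<in> S \<and> y = f x)"
    from drelD[OF this, of 0 1] show "definable_fun F 1 {x \<in> Rn 1. x 0 \<in> S} (\<lambda>x. f (x 0))"
      unfolding eq dpred_def by auto
  qed
qed

text \<open>Values of \<open>f\<close> up to \<open>c\<close> are left unconstrained, as befits a
  total function that represents one on a ray.\<close>

definition dgraph :: "(nat \<Rightarrow> ((nat \<Rightarrow> real) \<Rightarrow> real) set) \<Rightarrow> real \<Rightarrow> (real \<Rightarrow> real) \<Rightarrow> bool" where
  "dgraph F c f \<longleftrightarrow> drel F (\<lambda>x y. c < x \<and> y = f x)"

lemma dgraphD: "dgraph F c f \<Longrightarrow> dpred F (\<lambda>e. c < e i \<and> e j = f (e i))"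
  unfolding dgraph_def using drelD[of F "\<lambda>x y. c < x \<and> y = f x"] .

lemma dgraphI: "dpred F (\<lambda>e. c < e 0 \<and> e 1 = f (e 0)) \<Longrightarrow> dgraph F c f"
  unfolding dgraph_def by (rule drelI)

lemma dgraph_const: "dgraph F c (\<lambda>_. r)"
  by (rule dgraphI) (intro dpred_intros)

text \<open>The two values are named by bound variables. Their indices \<open>2\<close> and
  \<open>3\<close> avoid \<open>0\<close> and \<open>1\<close>, which hold the argument and the
  result.\<close>

lemma dgraph_binop:
  assumes op: "\<And>i j k. dpred F (\<lambda>e. e i = g (e j) (e k))"
    and f1: "dgraph F c f1" and f2: "dgraph F c f2"
  shows "dgraph F c (\<lambda>x. g (f1 x) (f2 x))"
proof (rule dgraphI)
  have "dpred F (\<lambda>e. \<exists>u v. (c < e 0 \<and> u = f1 (e 0)) \<and> (c < e 0 \<and> v = f2 (e 0)) \<and> e 1 = g u v)"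
    by (rule dpred_ex[where i = 2], rule dpred_ex[where i = 3])
      (rule dpred_conj[OF dgraphD[OF f1] dpred_conj[OF dgraphD[OF f2] op]], simp_all)
  moreover have "(\<exists>u v. (c < e 0 \<and> u = f1 (e 0)) \<and> (c < e 0 \<and> v = f2 (e 0)) \<and> e 1 = g u v)
      \<longleftrightarrow> c < e 0 \<and> e 1 = g (f1 (e 0)) (f2 (e 0))" for e :: "nat \<Rightarrow> real"
    by auto
  ultimately show "dpred F (\<lambda>e. c < e 0 \<and> e 1 = g (f1 (e 0)) (f2 (e 0)))" by simp
qed

lemma dgraph_add: "dgraph F c f \<Longrightarrow> dgraph F c g \<Longrightarrow> dgraph F c (\<lambda>x. f x + g x)"
  by (rule dgraph_binop[where g = "(+)"]) (intro dpred_intros)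

lemma dgraph_mult: "dgraph F c f \<Longrightarrow> dgraph F c g \<Longrightarrow> dgraph F c (\<lambda>x. f x * g x)"
  by (rule dgraph_binop[where g = "(*)"]) (intro dpred_intros)

lemma dgraph_mono:
  assumes "dgraph F c f" "c \<le> d"
  shows "dgraph F d f"
proof (rule dgraphI)
  have "dpred F (\<lambda>e. d < e 0 \<and> (c < e 0 \<and> e 1 = f (e 0)))"
    by (rule dpred_conj[OF _ dgraphD[OF assms(1)]]) (intro dpred_intros)
  moreover have "d < e 0 \<and> (c < e 0 \<and> e 1 = f (e 0)) \<longleftrightarrow> d < e 0 \<and> e 1 = f (e 0)"
    for e :: "nat \<Rightarrow> real"
    using assms(2) by auto
  ultimately show "dpred F (\<lambda>e. d < e 0 \<and> e 1 = f (e 0))" by simp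
qed

lemma dgraph_inverse:
  assumes f: "dgraph F c f" and nz: "\<And>x. c < x \<Longrightarrow> f x \<noteq> 0"
  shows "dgraph F c (\<lambda>x. inverse (f x))"
proof (rule dgraphI)
  \<comment> \<open>The equation \<open>e 1 * u = 1\<close> has no solution for
    \<open>u = 0\<close>, whereas \<open>inverse 0 = 0\<close>; \<open>nz\<close> excludes this
    discrepancy.\<close>
  have "dpred F (\<lambda>e. \<exists>u. (c < e 0 \<and> u = f (e 0)) \<and> e 1 * u = 1)"
    by (rule dpred_ex[where i = 2], rule dpred_conj[OF dgraphD[OF f]])
      (intro dpred_intros, simp)
  moreover have "(\<exists>u. (c < e 0 \<and> u = f (e 0)) \<and> e 1 * u = 1) \<longleftrightarrow>
      c < e 0 \<and> e 1 = inverse (f (e 0))" for e :: "nat \<Rightarrow> real"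
    using nz[of "e 0"] by (auto simp: field_simps)
  ultimately show "dpred F (\<lambda>e. c < e 0 \<and> e 1 = inverse (f (e 0)))" by simp
qed

text \<open>Squares replace absolute values, so that all inequalities are between polynomials in the
  values involved; this is sound because \<open>\<epsilon>\<close> and \<open>\<delta>\<close> are
  positive. The variable \<open>z\<close> is confined to the ray since the graph is accessible only
  there.\<close>

lemma has_real_derivative_on_ray_iff:
  fixes f :: "real \<Rightarrow> real"
  assumes "c < x"
  shows "(f has_real_derivative y) (at x) \<longleftrightarrow>
    (\<forall>\<epsilon>. 0 < \<epsilon> \<longrightarrow> (\<exists>\<delta>. 0 < \<delta> \<and> (\<forall>z. c < z \<and> (z - x)^2 < \<delta>^2 \<longrightarrow>
       (f z - f x - y * (z - x))^2 \<le> (\<epsilon> * (z - x))^2)))" (is "_ \<longleftrightarrow> ?R")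
proof -
  have D: "(f has_real_derivative y) (at x) \<longleftrightarrow>
      (\<forall>\<epsilon>>0. \<exists>\<delta>>0. \<forall>z. \<bar>z - x\<bar> < \<delta> \<longrightarrow> \<bar>f z - f x - y * (z - x)\<bar> \<le> \<epsilon> * \<bar>z - x\<bar>)"
    unfolding has_field_derivative_def has_derivative_at_alt
    by (simp add: bounded_linear_mult_right)
  have lt: "(z - x)^2 < \<delta>^2 \<longleftrightarrow> \<bar>z - x\<bar> < \<delta>" if "0 < \<delta>" for z \<delta>
    using abs_le_square_iff[of \<delta> "z - x"] abs_of_pos[OF that] by linarith
  have le: "(f z - f x - y * (z - x))^2 \<le> (\<epsilon> * (z - x))^2 \<longleftrightarrow>
      \<bar>f z - f x - y * (z - x)\<bar> \<le> \<epsilon> * \<bar>z - x\<bar>" if "0 < \<epsilon>" for z \<epsilon>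
    using abs_le_square_iff[of "f z - f x - y * (z - x)" "\<epsilon> * (z - x)"] abs_of_pos[OF that]
    by (simp only: abs_mult)
  have ex: "(\<exists>\<delta>>0. \<forall>z. c < z \<and> \<bar>z - x\<bar> < \<delta> \<longrightarrow> A z) \<longleftrightarrow> (\<exists>\<delta>>0. \<forall>z. \<bar>z - x\<bar> < \<delta> \<longrightarrow> A z)" for A
  proof
    assume "\<exists>\<delta>>0. \<forall>z. c < z \<and> \<bar>z - x\<bar> < \<delta> \<longrightarrow> A z"
    then obtain \<delta> where "\<delta> > 0" "\<forall>z. c < z \<and> \<bar>z - x\<bar> < \<delta> \<longrightarrow> A z" by blast
    \<comment> \<open>A radius of at most \<open>x - c\<close> keeps \<open>z\<close> on the
      ray.\<close>
    then show "\<exists>\<delta>>0. \<forall>z. \<bar>z - x\<bar> < \<delta> \<longrightarrow> A z"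
      using assms by (intro exI[of _ "min \<delta> (x - c)"]) auto
  qed blast
  have "(\<exists>\<delta>>0. \<forall>z. c < z \<and> (z - x)^2 < \<delta>^2 \<longrightarrow> (f z - f x - y * (z - x))^2 \<le> (\<epsilon> * (z - x))^2) \<longleftrightarrow>
      (\<exists>\<delta>>0. \<forall>z. \<bar>z - x\<bar> < \<delta> \<longrightarrow> \<bar>f z - f x - y * (z - x)\<bar> \<le> \<epsilon> * \<bar>z - x\<bar>)"
    if "0 < \<epsilon>" for \<epsilon>
    unfolding le[OF that] ex[of "\<lambda>z. \<bar>f z - f x - y * (z - x)\<bar> \<le> \<epsilon> * \<bar>z - x\<bar>", symmetric]
    using lt by blast
  then show ?thesis
    using D by blast
qed

text \<open>On the ray the condition holds for exactly one number \<open>e 1\<close>, the derivative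
  at \<open>e 0\<close>, so it defines the graph of \<open>f'\<close>.\<close>

lemma dgraph_derivative:
  assumes f: "dgraph F c f" and d: "\<And>x. c < x \<Longrightarrow> (f has_real_derivative f' x) (at x)"
  shows "dgraph F c f'"
proof (rule dgraphI)
  let ?P = "\<lambda>e::nat \<Rightarrow> real. c < e 0 \<and> (\<forall>\<epsilon>. 0 < \<epsilon> \<longrightarrow> (\<exists>\<delta>. 0 < \<delta> \<and>
     (\<forall>z u v. (c < e 0 \<and> u = f (e 0)) \<and> (c < z \<and> v = f z) \<and> (z - e 0)^2 < \<delta>^2 \<longrightarrow>
       (v - u - e 1 * (z - e 0))^2 \<le> (\<epsilon> * (z - e 0))^2)))"
  \<comment> \<open>The matrix is kept as a predicate in separate arguments so that the quantifiers
    can be added from the inside out, with \<open>\<epsilon> \<delta> z u v\<close> at indices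
    \<open>2\<close> to \<open>6\<close>. Here \<open>u\<close> and \<open>v\<close> name the values
    of \<open>f\<close> at \<open>x\<close> and \<open>z\<close>.\<close>
  define Q where "Q x y \<epsilon> \<delta> z u v \<longleftrightarrow>
      (c < x \<and> u = f x) \<and> (c < z \<and> v = f z) \<and> (z - x)^2 < \<delta>^2 \<longrightarrow>
      (v - u - y * (z - x))^2 \<le> (\<epsilon> * (z - x))^2" for x y \<epsilon> \<delta> z u v
  have "dpred F (\<lambda>e. Q (e 0) (e 1) (e 2) (e 3) (e 4) (e 5) (e 6))"
    unfolding Q_def
    by (rule dpred_imp[OF dpred_conj[OF dgraphD[OF f] dpred_conj[OF dgraphD[OF f]]]])
      (intro dpred_intros)+
  then have "dpred F (\<lambda>e. \<forall>v. Q (e 0) (e 1) (e 2) (e 3) (e 4) (e 5) v)"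
    by - (rule dpred_all[where i = 6], assumption, simp)
  then have "dpred F (\<lambda>e. \<forall>u v. Q (e 0) (e 1) (e 2) (e 3) (e 4) u v)"
    by - (rule dpred_all[where i = 5], assumption, simp)
  then have "dpred F (\<lambda>e. \<forall>z u v. Q (e 0) (e 1) (e 2) (e 3) z u v)"
    by - (rule dpred_all[where i = 4], assumption, simp)
  then have "dpred F (\<lambda>e. 0 < e 3 \<and> (\<forall>z u v. Q (e 0) (e 1) (e 2) (e 3) z u v))"
    by (intro dpred_conj dpred_less dterm_const dterm_var)
  then have "dpred F (\<lambda>e. \<exists>\<delta>. 0 < \<delta> \<and> (\<forall>z u v. Q (e 0) (e 1) (e 2) \<delta> z u v))"
    by - (rule dpred_ex[where i = 3], assumption, simp)
  then have "dpred F (\<lambda>e. 0 < e 2 \<longrightarrow> (\<exists>\<delta>. 0 < \<delta> \<and> (\<forall>z u v. Q (e 0) (e 1) (e 2) \<delta> z u v)))"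
    by (intro dpred_imp dpred_less dterm_const dterm_var)
  then have "dpred F (\<lambda>e. \<forall>\<epsilon>. 0 < \<epsilon> \<longrightarrow> (\<exists>\<delta>. 0 < \<delta> \<and> (\<forall>z u v. Q (e 0) (e 1) \<epsilon> \<delta> z u v)))"
    by - (rule dpred_all[where i = 2], assumption, simp)
  then have "dpred F ?P"
    unfolding Q_def by (intro dpred_conj[OF dpred_less] dterm_const dterm_var)
  moreover have "?P = (\<lambda>e. c < e 0 \<and> e 1 = f' (e 0))"
  proof (rule ext)
    fix e :: "nat \<Rightarrow> real"
    show "?P e \<longleftrightarrow> c < e 0 \<and> e 1 = f' (e 0)"
    proof (cases "c < e 0")
      case True
      have "(\<forall>z u v. (c < e 0 \<and> u = f (e 0)) \<and> (c < z \<and> v = f z) \<and> (z - e 0)^2 < \<delta>^2 \<longrightarrow>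
           (v - u - e 1 * (z - e 0))^2 \<le> (\<epsilon> * (z - e 0))^2) \<longleftrightarrow>
         (\<forall>z. c < z \<and> (z - e 0)^2 < \<delta>^2 \<longrightarrow>
           (f z - f (e 0) - e 1 * (z - e 0))^2 \<le> (\<epsilon> * (z - e 0))^2)" for \<epsilon> \<delta> :: real
        using True by blast
      then have "?P e \<longleftrightarrow> (f has_real_derivative e 1) (at (e 0))"
        unfolding has_real_derivative_on_ray_iff[OF True] using True by (simp only: simp_thms)
      also have "\<dots> \<longleftrightarrow> e 1 = f' (e 0)"
        using d[OF True] DERIV_unique by metis
      finally show ?thesis using True by blast
    qed blast
  qed
  ultimately show "dpred F (\<lambda>e. c < e 0 \<and> e 1 = f' (e 0))" by (rule back_subst)
qed

section \<open>Consequences of o-minimality\<close>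

text \<open>An interval contains a tail only if its upper endpoint is infinite and its lower one is
  not \<open>\<infinity>\<close>; otherwise it is bounded above or empty.\<close>

lemma eventually_mem_or_not_mem_interval:
  "(\<forall>\<^sub>F x in at_top. x \<in> einterval a b) \<or> (\<forall>\<^sub>F x in at_top. x \<notin> einterval a b)"
proof (cases "b = \<infinity> \<and> a \<noteq> \<infinity>")
  case True
  obtain r where "a \<le> ereal r" using True by (cases a) auto
  have "\<forall>\<^sub>F x in at_top. x \<in> einterval a b"
    using eventually_gt_at_top[of r]
  proof eventually_elim
    case (elim x)
    then show ?case using True \<open>a \<le> ereal r\<close> 
      by (auto simp: einterval_iff intro: le_less_trans)
  qed
  then show ?thesis ..
next
  case False
  then consider "a = \<infinity>" | "b \<noteq> \<infinity>" by blast
  then have "\<forall>\<^sub>F x in at_top. x \<notin> einterval a b"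
  proof cases
    case 2
    then obtain r where "b \<le> ereal r" by (cases b) auto
    show ?thesis
      using eventually_gt_at_top[of r]
    proof eventually_elim
      case (elim x)
      then show ?case using \<open>b \<le> ereal r\<close> by (auto simp: einterval_iff not_less intro: order_trans)
    qed
  qed (simp add: einterval_iff)
  then show ?thesis ..
qed

lemma o_minimal_eventually_zero_or_nonzero:
  assumes om: "o_minimal (zero_sets F)" and f: "dgraph F c f"
  shows "(\<forall>\<^sub>F x in at_top. f x = 0) \<or> (\<forall>\<^sub>F x in at_top. f x \<noteq> 0)"
proof -
  \<comment> \<open>Zero-sets belong to functions on the whole line, and a nonzero value off the ray
    adds no zeros.\<close>
  define h where "h x = (if c < x then f x else 1)" for x
  have "dpred F (\<lambda>e. (c < e 0 \<and> e 1 = f (e 0)) \<or> (e 0 \<le> c \<and> e 1 = 1))"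
    by (rule dpred_disj[OF dgraphD[OF f]]) (intro dpred_intros)
  moreover have "(c < e 0 \<and> e 1 = f (e 0)) \<or> (e 0 \<le> c \<and> e 1 = 1) \<longleftrightarrow>
      e 0 \<in> UNIV \<and> e 1 = h (e 0)" for e :: "nat \<Rightarrow> real"
    by (auto simp: h_def)
  ultimately have "drel F (\<lambda>x y. x \<in> UNIV \<and> y = h x)" by (intro drelI) simp
  then have "definable_fun F 1 (Rn 1) (\<lambda>x. h (x 0))"
    using definable_fun_unary_iff[of F UNIV h] by simp
  then have "{x \<in> Rn 1. h (x 0) = 0} \<in> zero_sets F 1"
    unfolding zero_sets_def by (intro CollectI exI[of _ "\<lambda>x. h (x 0)"] conjI refl)
  then have "\<exists>\<I>. finite \<I> \<and> (\<forall>I\<in>\<I>. (\<exists>p. I = {p}) \<or> (\<exists>a b. I = einterval a b)) \<and>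
      (\<lambda>x. x 0) ` {x \<in> Rn 1. h (x 0) = 0} = \<Union>\<I>"
    by (rule bspec[OF om[unfolded o_minimal_def]])
  then obtain \<I> where
    \<I>: "finite \<I>" "\<forall>I\<in>\<I>. (\<exists>p. I = {p}) \<or> (\<exists>a b. I = einterval a b)"
      "(\<lambda>x. x 0) ` {x \<in> Rn 1. h (x 0) = 0} = \<Union>\<I>"
    by (elim exE conjE)
  have "(\<lambda>x. x 0) ` {x \<in> Rn 1. h (x 0) = 0} = {x. h x = 0}"
  proof -
    have "x \<in> (\<lambda>x. x 0) ` {x \<in> Rn 1. h (x 0) = 0}" if "h x = 0" for x
      using that by (intro image_eqI[of _ _ "\<lambda>i. if i = 0 then x else 0"])
        (auto simp: topspace_Euclidean_space)
    then show ?thesis by auto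
  qed
  with \<I>(3) have Z: "h x = 0 \<longleftrightarrow> (\<exists>I\<in>\<I>. x \<in> I)" for x by auto
  have I: "(\<forall>\<^sub>F x in at_top. x \<in> I) \<or> (\<forall>\<^sub>F x in at_top. x \<notin> I)" if "I \<in> \<I>" for I
  proof -
    from \<I>(2) that have "(\<exists>p. I = {p}) \<or> (\<exists>a b. I = einterval a b)" by (rule bspec)
    then show ?thesis
    proof (elim disjE exE)
      fix p assume "I = {p}"
      moreover have "\<forall>\<^sub>F x in at_top. x \<noteq> p"
        using eventually_gt_at_top[of p] by eventually_elim simp
      ultimately show ?thesis by simp
    next
      fix a b assume "I = einterval a b"
      then show ?thesis using eventually_mem_or_not_mem_interval by simp
    qed
  qed
  have hf: "\<forall>\<^sub>F x in at_top. h x = f x"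
    using eventually_gt_at_top[of c] by eventually_elim (simp add: h_def)
  show ?thesis
  proof (cases "\<exists>I\<in>\<I>. \<forall>\<^sub>F x in at_top. x \<in> I")
    case True
    then have "\<forall>\<^sub>F x in at_top. h x = 0"
      unfolding Z by (auto elim: eventually_mono)
    with hf have "\<forall>\<^sub>F x in at_top. f x = 0" by eventually_elim simp
    then show ?thesis ..
  next
    case False
    \<comment> \<open>Each piece is avoided from some point on; finiteness of \<open>\<I>\<close>
      gives a common tail.\<close>
    then have "\<forall>\<^sub>F x in at_top. \<forall>I\<in>\<I>. x \<notin> I"
      using I \<I>(1) by (auto simp: eventually_ball_finite_distrib)
    with hf have "\<forall>\<^sub>F x in at_top. f x \<noteq> 0" by eventually_elim (use Z in metis)
    then show ?thesis ..
  qed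
qed

section \<open>Rings of germs\<close>

lemma germ_eq_iff: "germ f = germ g \<longleftrightarrow> (\<forall>\<^sub>F x in at_top. f x = g x)"
proof
  assume "germ f = germ g"
  moreover have "f \<in> germ f" by (simp add: germ_def)
  ultimately show "\<forall>\<^sub>F x in at_top. f x = g x" by (simp add: germ_def)
next
  assume fg: "\<forall>\<^sub>F x in at_top. f x = g x"
  have "(\<forall>\<^sub>F x in at_top. h x = f x) \<longleftrightarrow> (\<forall>\<^sub>F x in at_top. h x = g x)" for h
    using eventually_elim2[OF fg, of "\<lambda>x. h x = f x" "\<lambda>x. h x = g x"]
      eventually_elim2[OF fg, of "\<lambda>x. h x = g x" "\<lambda>x. h x = f x"] by auto
  then show "germ f = germ g" by (simp add: germ_def)
qed

lemma germ_binop: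
  "{h. \<exists>f'\<in>germ f. \<exists>g'\<in>germ g. \<forall>\<^sub>F x in at_top. h x = op (f' x) (g' x)} =
    germ (\<lambda>x. op (f x) (g x))" (is "?L = ?R")
proof
  show "?L \<subseteq> ?R"
  proof
    fix h assume "h \<in> ?L"
    then obtain f' g' where
      "\<forall>\<^sub>F x in at_top. f' x = f x" "\<forall>\<^sub>F x in at_top. g' x = g x"
      "\<forall>\<^sub>F x in at_top. h x = op (f' x) (g' x)"
      by (auto simp: germ_def)
    then have "\<forall>\<^sub>F x in at_top. h x = op (f x) (g x)" by eventually_elim simp
    then show "h \<in> ?R" by (simp add: germ_def)
  qed
  show "?R \<subseteq> ?L"
  proof
    fix h assume "h \<in> ?R"
    then have "\<forall>\<^sub>F x in at_top. h x = op (f x) (g x)" by (simp add: germ_def)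
    moreover have "f \<in> germ f" "g \<in> germ g" by (simp_all add: germ_def)
    ultimately show "h \<in> ?L" by blast
  qed
qed

lemma germ_ring_simps:
  "carrier (germ_ring H) = H"
  "\<one>\<^bsub>germ_ring H\<^esub> = germ (\<lambda>_. 1)"
  "\<zero>\<^bsub>germ_ring H\<^esub> = germ (\<lambda>_. 0)"
  "germ f \<otimes>\<^bsub>germ_ring H\<^esub> germ g = germ (\<lambda>x. f x * g x)"
  "germ f \<oplus>\<^bsub>germ_ring H\<^esub> germ g = germ (\<lambda>x. f x + g x)"
  by (simp_all add: germ_ring_def germ_binop)

text \<open>The ring is abstract and its operations are prescribed only on germs from
  \<open>P\<close>, because the same argument serves \<open>germ_ring\<close> and the underlying
  ring of the \<open>C^\<infinity>\<close>-ring, whose operations are defined differently.\<close>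

lemma cring_of_germs:
  fixes R (structure)
  assumes carr: "carrier R = germ ` P"
    and zero: "\<zero> = germ (\<lambda>_. 0)" and one: "\<one> = germ (\<lambda>_. 1)"
    and add: "\<And>f g. f \<in> P \<Longrightarrow> g \<in> P \<Longrightarrow> germ f \<oplus> germ g = germ (\<lambda>x. f x + g x)"
    and mult: "\<And>f g. f \<in> P \<Longrightarrow> g \<in> P \<Longrightarrow> germ f \<otimes> germ g = germ (\<lambda>x. f x * g x)"
    and P_const: "\<And>r. (\<lambda>_. r) \<in> P"
    and P_add: "\<And>f g. f \<in> P \<Longrightarrow> g \<in> P \<Longrightarrow> (\<lambda>x. f x + g x) \<in> P"
    and P_mult: "\<And>f g. f \<in> P \<Longrightarrow> g \<in> P \<Longrightarrow> (\<lambda>x. f x * g x) \<in> P"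
  shows "cring R"
proof (rule cringI)
  note ops = carr zero one add mult P_const P_add P_mult
  show "abelian_group R"
  proof (rule abelian_groupI)
    fix x assume "x \<in> carrier R"
    then obtain f where f: "f \<in> P" "x = germ f" using carr by auto
    \<comment> \<open>Negatives come from the constant \<open>- 1\<close>, which spares a separate
      closure condition on \<open>P\<close>.\<close>
    have "(\<lambda>t. - 1 * f t) \<in> P" using f P_mult P_const by blast
    then show "\<exists>y\<in>carrier R. y \<oplus> x = \<zero>"
      using f by (intro bexI[of _ "germ (\<lambda>t. - 1 * f t)"]) (simp_all add: ops)
  qed (auto simp: ops algebra_simps)
  show "comm_monoid R"
    by (rule comm_monoidI) (auto simp: ops algebra_simps)
  show "(x \<oplus> y) \<otimes> z = x \<otimes> z \<oplus> y \<otimes> z"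
    if "x \<in> carrier R" "y \<in> carrier R" "z \<in> carrier R" for x y z
    using that by (auto simp: ops algebra_simps)
qed

text \<open>A nonzero germ is merely not eventually zero, which still allows zeros arbitrarily far
  out. \<open>P_inverse\<close> excludes these; it is the place where o-minimality enters.\<close>

lemma field_of_germs:
  fixes R (structure)
  assumes carr: "carrier R = germ ` P"
    and zero: "\<zero> = germ (\<lambda>_. 0)" and one: "\<one> = germ (\<lambda>_. 1)"
    and add: "\<And>f g. f \<in> P \<Longrightarrow> g \<in> P \<Longrightarrow> germ f \<oplus> germ g = germ (\<lambda>x. f x + g x)"
    and mult: "\<And>f g. f \<in> P \<Longrightarrow> g \<in> P \<Longrightarrow> germ f \<otimes> germ g = germ (\<lambda>x. f x * g x)"
    and P_const: "\<And>r. (\<lambda>_. r) \<in> P"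
    and P_add: "\<And>f g. f \<in> P \<Longrightarrow> g \<in> P \<Longrightarrow> (\<lambda>x. f x + g x) \<in> P"
    and P_mult: "\<And>f g. f \<in> P \<Longrightarrow> g \<in> P \<Longrightarrow> (\<lambda>x. f x * g x) \<in> P"
    and P_inverse: "\<And>f. f \<in> P \<Longrightarrow> (\<forall>\<^sub>F x in at_top. f x = 0) \<or>
      (\<forall>\<^sub>F x in at_top. f x \<noteq> 0) \<and> (\<lambda>x. inverse (f x)) \<in> P"
  shows "field R"
proof -
  interpret cring R by (rule cring_of_germs[OF assms(1-8)])
  show ?thesis
  proof (rule cring_fieldI2)
    show "\<zero> \<noteq> \<one>" by (simp add: zero one germ_eq_iff)
    fix a assume "a \<in> carrier R" "a \<noteq> \<zero>"
    then obtain f where f: "f \<in> P" "a = germ f" using carr by auto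
    with \<open>a \<noteq> \<zero>\<close> have "\<not> (\<forall>\<^sub>F x in at_top. f x = 0)" by (simp add: zero germ_eq_iff)
    with P_inverse[OF f(1)] have
      nz: "\<forall>\<^sub>F x in at_top. f x \<noteq> 0" and inv: "(\<lambda>x. inverse (f x)) \<in> P" by auto
    have "\<forall>\<^sub>F x in at_top. f x * inverse (f x) = 1"
      using nz by eventually_elim simp
    then have "a \<otimes> germ (\<lambda>x. inverse (f x)) = \<one>"
      by (simp add: f mult inv one germ_eq_iff)
    then show "\<exists>b\<in>carrier R. a \<otimes> b = \<one>"
      using inv carr by blast
  qed
qed

section \<open>The Hardy field of definable smooth germs\<close>

definition smooth_at_top :: "(real \<Rightarrow> real) \<Rightarrow> bool" where
  "smooth_at_top f \<longleftrightarrow> (\<exists>c. \<forall>k. Dk k {c<..} f)"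

definition definable_smooth_at_top ::
    "(nat \<Rightarrow> ((nat \<Rightarrow> real) \<Rightarrow> real) set) \<Rightarrow> (real \<Rightarrow> real) \<Rightarrow> bool" where
  "definable_smooth_at_top F f \<longleftrightarrow> (\<exists>c. dgraph F c f \<and> (\<forall>k. Dk k {c<..} f))"

text \<open>An endpoint \<open>-\<infinity>\<close> can be replaced by any real number, since
  shrinking the ray does not change the germ. From here on all rays have real endpoints.\<close>

lemma definable_germs_eq: "definable_germs F = germ ` {f. definable_smooth_at_top F f}"
proof -
  have "(\<exists>c. definable_smooth_unary F c f) \<longleftrightarrow> definable_smooth_at_top F f" for f
  proof
    assume "\<exists>c. definable_smooth_unary F c f"
    then obtain c where c: "c \<noteq> \<infinity>" "smooth_on_open (einterval c \<infinity>) f"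
      "drel F (\<lambda>x y. x \<in> einterval c \<infinity> \<and> y = f x)"
      unfolding definable_smooth_unary_def definable_fun_unary_iff by blast
    obtain r :: real where r: "c \<le> ereal r" using c(1) by (cases c) auto
    have sub: "{r<..} \<subseteq> einterval c \<infinity>"
    proof
      fix x assume "x \<in> {r<..}"
      then have "ereal r < ereal x" by simp
      with r have "c < ereal x" by (rule le_less_trans)
      then show "x \<in> einterval c \<infinity>" by (simp add: einterval_iff)
    qed
    have "\<forall>k. Dk k {r<..} f"
      using c(2) smooth_on_open_iff_Dk Dk_mono[OF sub] by auto
    moreover have "dgraph F r f"
    proof (rule dgraphI)
      have "dpred F (\<lambda>e. r < e 0 \<and> (e 0 \<in> einterval c \<infinity> \<and> e 1 = f (e 0)))"
        by (intro dpred_conj drelD[OF c(3)]) (intro dpred_intros)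
      moreover have "r < e 0 \<and> (e 0 \<in> einterval c \<infinity> \<and> e 1 = f (e 0)) \<longleftrightarrow>
          r < e 0 \<and> e 1 = f (e 0)" for e :: "nat \<Rightarrow> real"
        using sub by auto
      ultimately show "dpred F (\<lambda>e. r < e 0 \<and> e 1 = f (e 0))" by simp
    qed
    ultimately show "definable_smooth_at_top F f"
      unfolding definable_smooth_at_top_def by blast
  next
    assume "definable_smooth_at_top F f"
    then obtain c where c: "dgraph F c f" "\<And>k. Dk k {c<..} f"
      unfolding definable_smooth_at_top_def by blast
    have "einterval (ereal c) \<infinity> = {c<..}" by (auto simp: einterval_iff)
    then have "definable_smooth_unary F (ereal c) f"
      unfolding definable_smooth_unary_def definable_fun_unary_iff
      using c smooth_on_open_iff_Dk[of "{c<..}"] by (simp add: dgraph_def)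
    then show "\<exists>c. definable_smooth_unary F c f" by blast
  qed
  then show ?thesis by (auto simp: definable_germs_def)
qed

lemma definable_smooth_at_top_common:
  assumes "definable_smooth_at_top F f" "definable_smooth_at_top F g"
  obtains c where "dgraph F c f" "dgraph F c g" "\<And>k. Dk k {c<..} f" "\<And>k. Dk k {c<..} g"
proof -
  obtain a b where ab: "dgraph F a f" "\<And>k. Dk k {a<..} f" "dgraph F b g" "\<And>k. Dk k {b<..} g"
    using assms unfolding definable_smooth_at_top_def by blast
  show thesis
    by (rule that[of "max a b"])
      (auto intro: dgraph_mono[OF ab(1)] dgraph_mono[OF ab(3)] Dk_mono[OF _ ab(2)] Dk_mono[OF _ ab(4)])
qed

lemma definable_smooth_at_top_const: "definable_smooth_at_top F (\<lambda>_. r)"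
  unfolding definable_smooth_at_top_def using dgraph_const Dk_const by blast

lemma definable_smooth_at_top_add:
  "definable_smooth_at_top F f \<Longrightarrow> definable_smooth_at_top F g \<Longrightarrow>
    definable_smooth_at_top F (\<lambda>x. f x + g x)"
  by (rule definable_smooth_at_top_common[of F f g])
    (auto simp: definable_smooth_at_top_def intro!: dgraph_add Dk_add)

lemma definable_smooth_at_top_mult:
  "definable_smooth_at_top F f \<Longrightarrow> definable_smooth_at_top F g \<Longrightarrow>
    definable_smooth_at_top F (\<lambda>x. f x * g x)"
  by (rule definable_smooth_at_top_common[of F f g])
    (auto simp: definable_smooth_at_top_def intro!: dgraph_mult Dk_mult)

lemma definable_smooth_at_top_inverse:
  assumes "o_minimal (zero_sets F)" "definable_smooth_at_top F f"
  shows "(\<forall>\<^sub>F x in at_top. f x = 0) \<or>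
    (\<forall>\<^sub>F x in at_top. f x \<noteq> 0) \<and> definable_smooth_at_top F (\<lambda>x. inverse (f x))"
proof (cases "\<forall>\<^sub>F x in at_top. f x = 0")
  case False
  obtain c where c: "dgraph F c f" "\<And>k. Dk k {c<..} f"
    using assms(2) unfolding definable_smooth_at_top_def by blast
  from False have nz: "\<forall>\<^sub>F x in at_top. f x \<noteq> 0"
    using o_minimal_eventually_zero_or_nonzero[OF assms(1) c(1)] by blast
  then obtain d where d: "\<And>x. x > d \<Longrightarrow> f x \<noteq> 0"
    unfolding eventually_at_top_dense by blast
  define b where "b = max c d"
  have "dgraph F b f" using dgraph_mono[OF c(1)] by (simp add: b_def)
  moreover have "Dk k {b<..} f" for k
    by (rule Dk_mono[OF _ c(2)]) (auto simp: b_def)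
  moreover have "f x \<noteq> 0" if "x > b" for x using d that by (simp add: b_def)
  ultimately have "definable_smooth_at_top F (\<lambda>x. inverse (f x))"
    unfolding definable_smooth_at_top_def
    by (intro exI[of _ b] conjI allI dgraph_inverse Dk_inverse) auto
  with nz show ?thesis by blast
qed simp

lemma definable_smooth_at_top_derivative:
  assumes "definable_smooth_at_top F f"
  obtains c f' where "\<And>x. c < x \<Longrightarrow> (f has_real_derivative f' x) (at x)"
    "definable_smooth_at_top F f'"
proof -
  obtain c where c: "dgraph F c f" "\<And>k. Dk k {c<..} f"
    using assms unfolding definable_smooth_at_top_def by blast
  obtain f' where f': "\<And>x. c < x \<Longrightarrow> (f has_real_derivative f' x) (at x)"
    using c(2)[of "Suc 0"] by auto
  \<comment> \<open>Each order provides its own witness for the first derivative; uniqueness of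
    derivatives identifies them all with the one \<open>f'\<close> fixed before.\<close>
  have "Dk k {c<..} f'" for k
  proof -
    obtain g where g: "\<And>x. c < x \<Longrightarrow> (f has_real_derivative g x) (at x)" "Dk k {c<..} g"
      using c(2)[of "Suc k"] by auto
    show ?thesis
      by (rule Dk_cong[OF _ _ g(2)]) (auto intro: DERIV_unique[OF g(1) f'])
  qed
  with dgraph_derivative[OF c(1) f'] f' show thesis
    using that unfolding definable_smooth_at_top_def by blast
qed

lemma hardy_field_definable_germs:
  assumes "o_minimal (zero_sets F)"
  shows "hardy_field (definable_germs F)"
  unfolding hardy_field_def
proof (intro conjI allI impI)
  let ?P = "{f. definable_smooth_at_top F f}"
  show "definable_germs F \<subseteq> continuous_germs"
  proof
    fix u assume "u \<in> definable_germs F"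
    then obtain f where f: "definable_smooth_at_top F f" "u = germ f"
      by (auto simp: definable_germs_eq)
    obtain c f' where "\<And>x. c < x \<Longrightarrow> (f has_real_derivative f' x) (at x)"
      using definable_smooth_at_top_derivative[OF f(1)] by metis
    then have "continuous_on {c<..} f"
      by (intro DERIV_continuous_on) (auto intro: has_field_derivative_at_within)
    with f(2) show "u \<in> continuous_germs" unfolding continuous_germs_def by blast
  qed
  show "field (germ_ring (definable_germs F))"
    by (rule field_of_germs[of _ ?P])
      (auto simp: germ_ring_simps definable_germs_eq intro: definable_smooth_at_top_const
        definable_smooth_at_top_add definable_smooth_at_top_mult
        dest: definable_smooth_at_top_inverse[OF assms])
  \<comment> \<open>An arbitrary representative \<open>f\<close> need not be definable, so the
    derivative is taken from a definable \<open>g\<close>. Equality on an open tail passes it on to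
    \<open>f\<close>.\<close>
  fix f assume "germ f \<in> definable_germs F"
  then obtain g where g: "definable_smooth_at_top F g" "\<forall>\<^sub>F x in at_top. f x = g x"
    by (auto simp: definable_germs_eq germ_eq_iff)
  from g(1) obtain c g' where g': "\<And>x. c < x \<Longrightarrow> (g has_real_derivative g' x) (at x)"
    "definable_smooth_at_top F g'"
    using definable_smooth_at_top_derivative by blast
  obtain d where d: "\<And>x. x > d \<Longrightarrow> f x = g x"
    using g(2) unfolding eventually_at_top_dense by blast
  have "(f has_real_derivative g' x) (at x)" if "x > max c d" for x
    by (rule has_field_derivative_transform_within_open[OF g'(1), of x "{max c d<..}"])
      (use that d in auto)
  then have "\<forall>\<^sub>F x in at_top. (f has_real_derivative g' x) (at x)"
    unfolding eventually_at_top_dense by blast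
  with g'(2) show "\<exists>f'. (\<forall>\<^sub>F x in at_top. (f has_real_derivative f' x) (at x)) \<and>
      germ f' \<in> definable_germs F"
    by (auto simp: definable_germs_eq)
qed

section \<open>The \<open>C\<^sup>\<infinity>\<close>-ring of smooth germs\<close>

definition smooth_germs :: "(real \<Rightarrow> real) set set" where
  "smooth_germs = germ ` {f. smooth_at_top f}"

definition germ_rep :: "(real \<Rightarrow> real) set \<Rightarrow> real \<Rightarrow> real" where
  "germ_rep u = (SOME f. f \<in> u)"

definition germ_op ::
    "nat \<Rightarrow> ((nat \<Rightarrow> real) \<Rightarrow> real) \<Rightarrow> (nat \<Rightarrow> (real \<Rightarrow> real) set) \<Rightarrow> (real \<Rightarrow> real) set" where
  "germ_op m f c = germ (\<lambda>x. f (\<lambda>i. if i < m then germ_rep (c i) x else 0))"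

lemma eventually_germ_rep: "\<forall>\<^sub>F x in at_top. germ_rep (germ f) x = f x"
proof -
  have "f \<in> germ f" by (simp add: germ_def)
  then have "germ_rep (germ f) \<in> germ f" unfolding germ_rep_def by (rule someI[of "\<lambda>g. g \<in> germ f"])
  then show ?thesis by (simp add: germ_def)
qed

lemma smooth_at_top_cong:
  assumes "smooth_at_top f" "\<forall>\<^sub>F x in at_top. f x = g x"
  shows "smooth_at_top g"
proof -
  obtain c where c: "\<And>k. Dk k {c<..} f"
    using assms(1) unfolding smooth_at_top_def by blast
  obtain d where d: "\<And>x. x > d \<Longrightarrow> f x = g x"
    using assms(2) unfolding eventually_at_top_dense by blast
  have "Dk k {max c d<..} g" for k
    by (rule Dk_cong[of _ f]) (use d in \<open>auto intro: Dk_mono[OF _ c]\<close>)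
  then show ?thesis unfolding smooth_at_top_def by blast
qed

lemma smooth_at_top_germ_rep: "u \<in> smooth_germs \<Longrightarrow> smooth_at_top (germ_rep u)"
  unfolding smooth_germs_def
  using smooth_at_top_cong eventually_germ_rep by (auto simp: eq_commute)

lemma germ_germ_rep: "germ (germ_rep (germ f)) = germ f"
  by (simp add: germ_eq_iff eventually_germ_rep)

text \<open>Independence of the representatives chosen by \<open>germ_rep\<close>: there are
  finitely many arguments, so all the chosen functions agree with the \<open>h i\<close> on one
  tail.\<close>

lemma germ_op_germ: "germ_op m f (\<lambda>i\<in>{..<m}. germ (h i)) = germ (\<lambda>x. f (\<lambda>i. if i < m then h i x else 0))"
proof -
  have "\<forall>\<^sub>F x in at_top. \<forall>i\<in>{..<m}. germ_rep (germ (h i)) x = h i x"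
    by (intro eventually_ball_finite) (auto simp: eventually_germ_rep)
  then have "\<forall>\<^sub>F x in at_top.
      f (\<lambda>i. if i < m then germ_rep ((\<lambda>i\<in>{..<m}. germ (h i)) i) x else 0) =
      f (\<lambda>i. if i < m then h i x else 0)"
    by eventually_elim (intro arg_cong[of _ _ f], auto)
  then show ?thesis by (simp only: germ_op_def germ_eq_iff)
qed

lemma smooth_at_top_common:
  fixes m :: nat
  assumes "\<And>i. i < m \<Longrightarrow> smooth_at_top (h i)"
  obtains c where "\<And>i k. i < m \<Longrightarrow> Dk k {c<..} (h i)"
proof -
  obtain d where d: "\<And>i k. i < m \<Longrightarrow> Dk k {d i<..} (h i)"
    using assms unfolding smooth_at_top_def by metis
  \<comment> \<open>The inserted \<open>0\<close> keeps the set nonempty when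
    \<open>m = 0\<close>.\<close>
  define c where "c = Max (insert 0 (d ` {..<m}))"
  have "d i \<le> c" if "i < m" for i
    unfolding c_def using that by (intro Max_ge) auto
  then have "Dk k {c<..} (h i)" if "i < m" for i k
    using that by (intro Dk_mono[OF _ d]) auto
  then show thesis by (rule that)
qed

lemma smooth_at_top_comp_Cinf:
  assumes "f \<in> Cinf m" "\<And>i. i < m \<Longrightarrow> smooth_at_top (h i)"
  shows "smooth_at_top (\<lambda>x. f (\<lambda>i. if i < m then h i x else 0))"
proof (rule smooth_at_top_common[OF assms(2)])
  fix c assume c: "\<And>i k. i < m \<Longrightarrow> Dk k {c<..} (h i)"
  have "Ck m k f" for k using assms(1) by (simp add: Cinf_def)
  then have "Dk k {c<..} (\<lambda>x. f (\<lambda>i. if i < m then h i x else 0))" for k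
    using c by (rule Dk_comp_Ck)
  then show ?thesis unfolding smooth_at_top_def by (intro exI allI)
qed

text \<open>After \<open>germ_op_germ\<close> both sides of the composition axiom are germs of the
  same function. The restrictions in \<open>proj_fun\<close> and \<open>comp_fun\<close> disappear
  because all evaluation points lie in \<open>Rn m\<close>.\<close>

lemma cinf_ring_smooth_germs: "cinf_ring smooth_germs germ_op"
  unfolding cinf_ring_def
proof (intro conjI allI ballI impI)
  fix m f c assume "f \<in> Cinf m" and c: "c \<in> {..<m} \<rightarrow>\<^sub>E smooth_germs"
  then have "smooth_at_top (\<lambda>x. f (\<lambda>i. if i < m then germ_rep (c i) x else 0))"
    by (intro smooth_at_top_comp_Cinf smooth_at_top_germ_rep) auto
  then show "germ_op m f c \<in> smooth_germs"
    by (simp add: germ_op_def smooth_germs_def)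
next
  fix m j :: nat and c assume "j < m" and c: "c \<in> {..<m} \<rightarrow>\<^sub>E smooth_germs"
  then obtain f where f: "c j = germ f" by (auto simp: smooth_germs_def PiE_iff)
  have "(\<lambda>i. if i < m then germ_rep (c i) x else 0) \<in> Rn m" for x
    by (simp add: topspace_Euclidean_space)
  with \<open>j < m\<close> show "germ_op m (proj_fun m j) c = c j"
    by (simp add: germ_op_def proj_fun_def f germ_germ_rep)
next
  fix m n :: nat and g f c
  have Rn: "(\<lambda>i. if i < m then germ_rep (c i) x else 0) \<in> Rn m" for x
    by (simp add: topspace_Euclidean_space)
  have "germ_op n g (\<lambda>i\<in>{..<n}. germ_op m (f i) c) =
      germ (\<lambda>x. g (\<lambda>i. if i < n then f i (\<lambda>i. if i < m then germ_rep (c i) x else 0) else 0))"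
    unfolding germ_op_def[of m] germ_op_germ ..
  then show "germ_op m (comp_fun m n g f) c = germ_op n g (\<lambda>i\<in>{..<n}. germ_op m (f i) c)"
    by (simp add: germ_op_def[of m] comp_fun_def Rn)
qed

lemma underlying_ring_smooth_germs_simps:
  defines "R \<equiv> underlying_ring smooth_germs germ_op"
  shows "carrier R = smooth_germs"
    and "\<one>\<^bsub>R\<^esub> = germ (\<lambda>_. 1)"
    and "\<zero>\<^bsub>R\<^esub> = germ (\<lambda>_. 0)"
    and "germ f \<otimes>\<^bsub>R\<^esub> germ g = germ (\<lambda>x. f x * g x)"
    and "germ f \<oplus>\<^bsub>R\<^esub> germ g = germ (\<lambda>x. f x + g x)"
proof -
  \<comment> \<open>This puts the argument into the form of a restricted family of germs that
    \<open>germ_op_germ\<close> evaluates.\<close>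
  have pair: "pair (germ f) (germ g) = (\<lambda>i\<in>{..<2}. germ (if i = 0 then f else g))"
    by (auto simp: pair_def fun_eq_iff)
  have Rn: "(\<lambda>i. if i < n then h i else 0) \<in> Rn n" for h n
    by (simp add: topspace_Euclidean_space)
  show "\<one>\<^bsub>R\<^esub> = germ (\<lambda>_. 1)" "\<zero>\<^bsub>R\<^esub> = germ (\<lambda>_. 0)"
    by (simp_all add: R_def underlying_ring_def germ_op_def topspace_Euclidean_space)
  show "germ f \<otimes>\<^bsub>R\<^esub> germ g = germ (\<lambda>x. f x * g x)" "germ f \<oplus>\<^bsub>R\<^esub> germ g = germ (\<lambda>x. f x + g x)"
    by (simp_all add: R_def underlying_ring_def pair germ_op_germ Rn)
qed (simp add: R_def underlying_ring_def)

lemma smooth_at_top_const: "smooth_at_top (\<lambda>_. r)"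
  by (simp add: smooth_at_top_def Dk_const)

lemma smooth_at_top_binop:
  assumes "smooth_at_top f" "smooth_at_top g"
  shows "smooth_at_top (\<lambda>x. f x + g x)" "smooth_at_top (\<lambda>x. f x * g x)"
proof -
  obtain a b where ab: "\<And>k. Dk k {a<..} f" "\<And>k. Dk k {b<..} g"
    using assms unfolding smooth_at_top_def by blast
  have "Dk k {max a b<..} f" "Dk k {max a b<..} g" for k
    by (auto intro: Dk_mono[OF _ ab(1)] Dk_mono[OF _ ab(2)])
  then show "smooth_at_top (\<lambda>x. f x + g x)" "smooth_at_top (\<lambda>x. f x * g x)"
    unfolding smooth_at_top_def by (blast intro: Dk_add Dk_mult)+
qed

lemma cring_underlying_ring_smooth_germs: "cring (underlying_ring smooth_germs germ_op)"
  by (rule cring_of_germs[of _ "{f. smooth_at_top f}"])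
    (auto simp: underlying_ring_smooth_germs_simps smooth_germs_def[symmetric]
      smooth_at_top_const smooth_at_top_binop)

lemma definable_germs_subset_smooth_germs: "definable_germs F \<subseteq> smooth_germs"
  unfolding definable_germs_eq smooth_germs_def definable_smooth_at_top_def smooth_at_top_def by blast

text \<open>Inverses of definable germs stay definable, so shrinking the carrier of the large ring
  leaves a field, although the large ring has nonzero germs without inverse.\<close>

lemma subfield_definable_germs:
  assumes "o_minimal (zero_sets F)"
  shows "subfield (definable_germs F) (underlying_ring smooth_germs germ_op)"
proof -
  let ?R = "underlying_ring smooth_germs germ_op"
  interpret cring ?R by (rule cring_underlying_ring_smooth_germs)
  have "field (?R\<lparr>carrier := definable_germs F\<rparr>)"
    by (rule field_of_germs[of _ "{f. definable_smooth_at_top F f}"])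
      (auto simp: underlying_ring_smooth_germs_simps definable_germs_eq
        intro: definable_smooth_at_top_const
        definable_smooth_at_top_add definable_smooth_at_top_mult
        dest: definable_smooth_at_top_inverse[OF assms])
  then show ?thesis
    by (rule subfield_iff(1))
      (simp add: underlying_ring_smooth_germs_simps definable_germs_subset_smooth_germs)
qed

theorem theorem6:
  fixes F :: "nat \<Rightarrow> ((nat \<Rightarrow> real) \<Rightarrow> real) set"
  assumes "\<And>n. F n \<subseteq> Cinf n"
    and "o_minimal (zero_sets F)"
  shows "hardy_field (definable_germs F) \<and>
    (\<exists>(A :: (real \<Rightarrow> real) set set) \<Phi> K.
       cinf_ring A \<Phi> \<and> subfield K (underlying_ring A \<Phi>) \<and>
       germ_ring (definable_germs F) \<simeq> (underlying_ring A \<Phi>)\<lparr>carrier := K\<rparr>)"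
proof (intro conjI exI)
  show "hardy_field (definable_germs F)"
    using assms(2) by (rule hardy_field_definable_germs)
  show "cinf_ring smooth_germs germ_op" by (rule cinf_ring_smooth_germs)
  show "subfield (definable_germs F) (underlying_ring smooth_germs germ_op)"
    using assms(2) by (rule subfield_definable_germs)
  \<comment> \<open>The operations of the two rings are different functions, but on germs of
    functions both are pointwise, so the identity respects them.\<close>
  have "id \<in> ring_iso (germ_ring (definable_germs F))
      ((underlying_ring smooth_germs germ_op)\<lparr>carrier := definable_germs F\<rparr>)"
    by (rule ring_iso_memI)
      (auto simp: germ_ring_simps underlying_ring_smooth_germs_simps definable_germs_eq)
  then show "germ_ring (definable_germs F) \<simeq>
      (underlying_ring smooth_germs germ_op)\<lparr>carrier := definable_germs F\<rparr>"
    unfolding is_ring_iso_def by blast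
qed

end
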